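(* Let $P$ be the condensation measure on $\mathbb{R}$ satisfying $P=\frac13 P\circ S_1^{-1}+\frac13 P\circ S_2^{-1}+\frac13\nu$, with $S_1(x)=\frac15x$, $S_2(x)=\frac15x+\frac45$, where $\nu$ is the self-similar probability measure satisfying $\nu=\frac12\nu\circ T_1^{-1}+\frac12\nu\circ T_2^{-1}$ with $T_1(x)=\frac13x+\frac4{15}$, $T_2(x)=\frac13x+\frac25$. Let $\beta=\frac{\log2}{\log3}$. Then the $\beta$-dimensional quantization coefficient for $P$ does not exist (i.e. the sequence $n^{2/\beta}V_n(P)$ does not converge as $n\to\infty$); however, the $\beta$-dimensional lower and upper quantization coefficients $\liminf_{n\to\infty}n^{2/\beta}V_n(P)$ and $\limsup_{n\to\infty}n^{2/\beta}V_n(P)$ are finite and positive.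
   Context: For a Borel probability measure $\mu$ on $\mathbb{R}$ with compact support, $V_n(\mu)=\inf\{\int\min_{a\in\alpha}(x-a)^2\,d\mu(x):\alpha\subset\mathbb{R},\ 1\le\mathrm{card}(\alpha)\le n\}$ is the $n$th quantization error. The $s$-dimensional quantization coefficient of $\mu$ is $\lim_{n\to\infty}n^{2/s}V_n(\mu)$ if it exists. The measures $\nu$ and $P$ are the unique compactly supported Borel probability measures satisfying the displayed identities. *)

theory Defs
  imports "HOL-Probability.Probability"
begin

definition msupport :: "real measure \<Rightarrow> real set" where
  "msupport \<mu> = {x. \<forall>U. open U \<and> x \<in> U \<longrightarrow> emeasure \<mu> U > 0}"

definition compact_borel_prob :: "real measure \<Rightarrow> bool" where
  "compact_borel_prob \<mu> \<longleftrightarrow> prob_space \<mu> \<and> sets \<mu> = sets borel \<and> compact (msupport \<mu>)"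

(* For n = 0 the infimum is over the empty set and has no meaning; only n >= 1 matters below.
   For a compactly supported probability measure every integrand is integrable, so the real-valued
   integral and the real infimum (bounded below by 0) carry their usual meaning. *)
definition quantization_error :: "nat \<Rightarrow> real measure \<Rightarrow> real" where
  "quantization_error n \<mu> =
     Inf {(LINT x|\<mu>. Min ((\<lambda>a. (x - a)\<^sup>2) ` \<alpha>)) | \<alpha> :: real set.
            finite \<alpha> \<and> 1 \<le> card \<alpha> \<and> card \<alpha> \<le> n}"

definition quantization_seq :: "real \<Rightarrow> real measure \<Rightarrow> nat \<Rightarrow> real" where
  "quantization_seq s \<mu> n = real n powr (2 / s) * quantization_error n \<mu>"

(* The lower and upper coefficients are extended reals, so that their finiteness is a claim. *)
definition lower_quantization_coeff :: "real \<Rightarrow> real measure \<Rightarrow> ereal" where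
  "lower_quantization_coeff s \<mu> = liminf (\<lambda>n. ereal (quantization_seq s \<mu> n))"

definition upper_quantization_coeff :: "real \<Rightarrow> real measure \<Rightarrow> ereal" where
  "upper_quantization_coeff s \<mu> = limsup (\<lambda>n. ereal (quantization_seq s \<mu> n))"

definition T1 :: "real \<Rightarrow> real" where "T1 x = 1/3 * x + 4/15"
definition T2 :: "real \<Rightarrow> real" where "T2 x = 1/3 * x + 2/5"
definition S1 :: "real \<Rightarrow> real" where "S1 x = 1/5 * x"
definition S2 :: "real \<Rightarrow> real" where "S2 x = 1/5 * x + 4/5"

(* Equalities of finite Borel measures are stated setwise, as there is no addition on the
   type of measures. *)
definition self_similar_nu :: "real measure \<Rightarrow> bool" where
  "self_similar_nu \<nu> \<longleftrightarrow> (\<forall>A \<in> sets borel.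
     measure \<nu> A = 1/2 * measure (distr \<nu> borel T1) A + 1/2 * measure (distr \<nu> borel T2) A)"

definition condensation_identity :: "real measure \<Rightarrow> real measure \<Rightarrow> bool" where
  "condensation_identity \<nu> P \<longleftrightarrow> (\<forall>A \<in> sets borel.
     measure P A = 1/3 * measure (distr P borel S1) A + 1/3 * measure (distr P borel S2) A
                 + 1/3 * measure \<nu> A)"

end

(*
  Work with the penalised error pen M t = inf (Err M A + t * card A) over finite nonempty sets A;
  Err M A is the distortion of A.  It turns the allocation of points to the pieces of a self-similar
  measure into a plain sum:
    pen P t = 2/75 * pen P (75 t) + 1/300 * pen M (300 t) + O(t),
  where M is nu rescaled to [-1, 1].  With p = 2 / beta, the identity shows that pen P is of order
  t powr (p / (p + 1)), whence the upper bound; the lower bound comes from P >= nu / 3.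
  If n powr p * V_n(P) converged, then pen P t would be asymptotic to a multiple of
  t powr (p / (p + 1)), hence so would pen M, by the same identity.  For M itself one has
  pen M (1 / 18^j) >= 3/2 / 9^j and pen M (3/2 / 18^j) <= 2 / 9^j, and these two are incompatible
  with such a power law.
*)
theory Submission
  imports Defs "HOL-Real_Asymp.Real_Asymp"
begin

subsection \<open>Quantization and penalised errors\<close>

text \<open>The errors of \<open>P\<close> themselves obey no convenient recursion, since
  \<open>n\<close> points must be divided optimally among three pieces. A price \<open>t\<close> per
  point removes that constraint. A piece of weight w and contraction ratio r contributes w * r^2
  times a distortion in its own coordinates, so the price there is t / (w * r^2). This is the origin
  of the factors 75 (copies of \<open>P\<close>), 300 (rescaled \<open>\<nu>\<close>) and 18 (halves
  of \<open>M\<close>). Since 2 powr p = 9 and 2 powr (p + 1) = 18, the exponent p / (p + 1) is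
  exactly critical for \<open>M\<close>: 2/18 * 18 powr (p / (p + 1)) = 1. As 75 > 18, the copies of
  \<open>P\<close> have 2/75 * 75 powr (p / (p + 1)) < 1. They contract, and \<open>M\<close> alone
  decides the order. The power law fails for \<open>M\<close> because a single point at 0 costs 1/2
  + t, which is optimal at t = 1 and grows only by the factor 4/3 up to t = 3/2, too little for an
  exponent above 3/4. Self-similarity repeats this at every scale 18^-j.\<close>

definition sqdist :: "real set \<Rightarrow> real \<Rightarrow> real" where
  "sqdist A x = Min ((\<lambda>a. (x - a)\<^sup>2) ` A)"

lemma sqdist_le: "finite A \<Longrightarrow> a \<in> A \<Longrightarrow> sqdist A x \<le> (x - a)\<^sup>2"
  by (simp add: sqdist_def)

lemma sqdist_attained: 
  assumes "finite A" "A \<noteq> {}"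
  obtains a where "a \<in> A" "sqdist A x = (x - a)\<^sup>2"
proof -
  have "sqdist A x \<in> (\<lambda>a. (x - a)\<^sup>2) ` A"
    unfolding sqdist_def using assms by (intro Min_in) auto
  then show ?thesis using that by blast
qed

lemma sqdist_geI: 
  assumes "finite A" "A \<noteq> {}" "\<And>a. a \<in> A \<Longrightarrow> c \<le> (x - a)\<^sup>2"
  shows "c \<le> sqdist A x"
  using assms by (simp add: sqdist_def)

lemma sqdist_nonneg: "finite A \<Longrightarrow> A \<noteq> {} \<Longrightarrow> 0 \<le> sqdist A x"
  by (rule sqdist_geI) auto

lemma sqdist_singleton [simp]: "sqdist {a} x = (x - a)\<^sup>2"
  by (simp add: sqdist_def)

lemma sqdist_affine:
  assumes "finite A" "A \<noteq> {}" "c > 0"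
  shows "sqdist A (c * x + d) = c\<^sup>2 * sqdist ((\<lambda>y. (y - d) / c) ` A) x"
proof -
  have "c\<^sup>2 * (x - (a - d) / c)\<^sup>2 = (c * x + d - a)\<^sup>2" for a
  proof -
    have "c\<^sup>2 * (x - (a - d) / c)\<^sup>2 = (c * (x - (a - d) / c))\<^sup>2"
      by (simp add: power_mult_distrib)
    also have "c * (x - (a - d) / c) = c * x + d - a"
      using assms by (simp add: field_simps)
    finally show ?thesis .
  qed
  moreover have "mono (\<lambda>t::real. c\<^sup>2 * t)"
    by (intro monoI mult_left_mono) auto
  ultimately show ?thesis
    using mono_Min_commute[of "\<lambda>t. c\<^sup>2 * t" "(\<lambda>a. (x - a)\<^sup>2) ` ((\<lambda>y. (y - d) / c) ` A)"] assms
    by (simp add: sqdist_def image_image)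
qed

lemma continuous_sqdist:
  assumes "finite A" "A \<noteq> {}"
  shows "continuous_on S (sqdist A)"
  using assms
proof (induction rule: finite_ne_induct)
  case (singleton a)
  have "sqdist {a} = (\<lambda>x. (x - a)\<^sup>2)" by (auto simp: sqdist_def)
  then show ?case by (auto intro!: continuous_intros)
next
  case (insert a F)
  have "sqdist (insert a F) = (\<lambda>x. min ((x - a)\<^sup>2) (sqdist F x))"
    using insert by (intro ext) (simp add: sqdist_def)
  then show ?case using insert by (auto intro!: continuous_intros)
qed

lemma sqdist_le_sqdist:
  assumes "finite A" "A \<noteq> {}" "finite B" and "\<And>a. a \<in> A \<Longrightarrow> \<exists>b\<in>B. \<bar>x - b\<bar> \<le> \<bar>x - a\<bar>"
  shows "sqdist B x \<le> sqdist A x"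
proof (rule sqdist_geI[OF assms(1,2)])
  fix a assume "a \<in> A"
  then obtain b where "b \<in> B" "\<bar>x - b\<bar> \<le> \<bar>x - a\<bar>" using assms by blast
  then show "sqdist B x \<le> (x - a)\<^sup>2"
    using sqdist_le[OF assms(3), of b x] by (simp add: abs_le_square_iff)
qed

lemma sqdist_mono: 
  assumes "finite B" "A \<subseteq> B" "A \<noteq> {}" shows "sqdist B x \<le> sqdist A x"
  unfolding sqdist_def using assms by (intro Min_antimono) auto

definition Err :: "real measure \<Rightarrow> real set \<Rightarrow> real" where
  "Err M A = (LINT x|M. sqdist A x)"

lemma Err_nonneg: "finite A \<Longrightarrow> A \<noteq> {} \<Longrightarrow> 0 \<le> Err M A"
  unfolding Err_def by (intro integral_nonneg_AE) (auto simp: sqdist_nonneg)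

text \<open>A discrete Legendre transform: \<open>pen M t\<close> is the infimum over
  \<open>n \<ge> 1\<close> of \<open>quantization_error n M + t * n\<close>, with \<open>t\<close>
  in the role of a Lagrange multiplier for the number of points.\<close>

definition pen :: "real measure \<Rightarrow> real \<Rightarrow> real" where
  "pen M t = Inf {Err M A + t * real (card A) | A. finite A \<and> A \<noteq> {}}"

lemma pen_le:
  assumes "0 \<le> t" "finite A" "A \<noteq> {}" shows "pen M t \<le> Err M A + t * real (card A)"
  unfolding pen_def
proof (rule cInf_lower)
  show "bdd_below {Err M A + t * real (card A) |A. finite A \<and> A \<noteq> {}}"
    using assms by (intro bdd_belowI[of _ 0]) (auto intro!: add_nonneg_nonneg Err_nonneg)
qed (use assms in auto)

lemma pen_ge:
  assumes "\<And>A. finite A \<Longrightarrow> A \<noteq> {} \<Longrightarrow> c \<le> Err M A + t * real (card A)" 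
  shows "c \<le> pen M t"
  unfolding pen_def
proof (rule cInf_greatest)
  show "{Err M A + t * real (card A) |A. finite A \<and> A \<noteq> {}} \<noteq> {}"
    using finite.intros(2)[OF finite.intros(1), of "0::real"] by blast
qed (use assms in auto)

lemma pen_nonneg: "0 \<le> t \<Longrightarrow> 0 \<le> pen M t"
  by (rule pen_ge) (auto intro!: add_nonneg_nonneg Err_nonneg)

lemma pen_approx:
  assumes "pen M t < c"
  obtains A where "finite A" "A \<noteq> {}" "Err M A + t * real (card A) < c"
proof -
  have "\<not> (\<forall>A. finite A \<and> A \<noteq> {} \<longrightarrow> c \<le> Err M A + t * real (card A))"
    using pen_ge[of c M t] assms by force
  then show ?thesis using that by (meson not_le)
qed

lemma quantization_error_alt:
  "quantization_error n M = Inf {Err M A | A. finite A \<and> 1 \<le> card A \<and> card A \<le> n}"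
  by (simp add: quantization_error_def Err_def sqdist_def[abs_def])

lemma quantization_error_le:
  assumes "finite A" "A \<noteq> {}" "card A \<le> n" shows "quantization_error n M \<le> Err M A"
  unfolding quantization_error_alt
proof (rule cInf_lower)
  show "bdd_below {Err M A | A. finite A \<and> 1 \<le> card A \<and> card A \<le> n}"
    by (rule bdd_belowI[of _ 0]) (auto intro!: Err_nonneg)
qed (use assms in \<open>auto simp: Suc_le_eq card_gt_0_iff\<close>)

lemma quantization_error_ge:
  assumes "1 \<le> n" "\<And>A. finite A \<Longrightarrow> A \<noteq> {} \<Longrightarrow> card A \<le> n \<Longrightarrow> c \<le> Err M A" 
  shows "c \<le> quantization_error n M"
  unfolding quantization_error_alt
proof (rule cInf_greatest)
  show "{Err M A | A. finite A \<and> 1 \<le> card A \<and> card A \<le> n} \<noteq> {}"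
    using assms(1) by (auto intro!: exI[of _ "{0}"])
next
  fix x assume "x \<in> {Err M A | A. finite A \<and> 1 \<le> card A \<and> card A \<le> n}"
  then obtain A where "x = Err M A" "finite A" "1 \<le> card A" "card A \<le> n" by blast
  moreover from this have "A \<noteq> {}" by auto
  ultimately show "c \<le> x" using assms(2) by simp
qed

lemma pen_le_quantization_error:
  assumes "0 \<le> t" "1 \<le> n"
  shows "pen M t \<le> quantization_error n M + t * real n"
proof -
  have "pen M t - t * real n \<le> quantization_error n M"
  proof (rule quantization_error_ge[OF assms(2)])
    fix A :: "real set" assume A: "finite A" "A \<noteq> {}" "card A \<le> n"
    have "t * real (card A) \<le> t * real n" using A assms by (intro mult_left_mono) auto
    then show "pen M t - t * real n \<le> Err M A" using pen_le[OF assms(1) A(1,2), of M] by linarith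
  qed
  then show ?thesis by simp
qed

lemma quantization_error_antimono:
  assumes "1 \<le> m" "m \<le> n" shows "quantization_error n M \<le> quantization_error m M"
  by (rule quantization_error_ge[OF assms(1)], rule quantization_error_le) (use assms in auto)

lemma pen_ge_quantization_error:
  assumes "\<And>n. 1 \<le> n \<Longrightarrow> c \<le> quantization_error n M + t * real n"
  shows "c \<le> pen M t"
proof (rule pen_ge)
  fix A :: "real set" assume A: "finite A" "A \<noteq> {}"
  then have "1 \<le> card A" by (simp add: Suc_le_eq card_gt_0_iff)
  from assms[OF this] quantization_error_le[OF A order_refl, of M] 
  show "c \<le> Err M A + t * real (card A)" by linarith
qed

section \<open>Integration against setwise mixtures of measures\<close>

text \<open>The measure identities are setwise, so they are lifted to integrals by induction over
  nonnegative Borel functions. Three components cover both identities; for \<open>\<nu>\<close> the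
  third weight is 0.\<close>

lemma nn_integral_mixture:
  fixes M N1 N2 N3 :: "real measure"
  assumes "finite_measure M" "finite_measure N1" "finite_measure N2" "finite_measure N3"
    and sets: "sets M = sets borel" "sets N1 = sets borel" "sets N2 = sets borel" "sets N3 = sets borel"
    and nn: "0 \<le> a" "0 \<le> b" "0 \<le> c"
    and eq: "\<And>X. X \<in> sets borel \<Longrightarrow> measure M X = a * measure N1 X + b * measure N2 X + c * measure N3 X"
    and f: "f \<in> borel_measurable borel"
  shows "(\<integral>\<^sup>+x. f x \<partial>M) = ennreal a * (\<integral>\<^sup>+x. f x \<partial>N1) + ennreal b * (\<integral>\<^sup>+x. f x \<partial>N2)
           + ennreal c * (\<integral>\<^sup>+x. f x \<partial>N3)"
  using f
proof (induction rule: borel_measurable_induct)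
  case (cong f g)
  then show ?case by (simp cong: nn_integral_cong)
next
  case (set X)
  interpret M: finite_measure M by fact
  interpret N1: finite_measure N1 by fact
  interpret N2: finite_measure N2 by fact
  interpret N3: finite_measure N3 by fact
  show ?case using set sets nn
    by (simp add: M.emeasure_eq_measure N1.emeasure_eq_measure N2.emeasure_eq_measure 
        N3.emeasure_eq_measure eq ennreal_plus[symmetric] ennreal_mult[symmetric] del: ennreal_plus)
next
  case (mult u k)
  note [measurable_cong] = sets
  note [measurable] = mult(2)
  show ?case using mult by (simp add: nn_integral_cmult distrib_left mult.left_commute)
next
  case (add u v)
  note [measurable_cong] = sets
  note [measurable] = add(1,3)
  show ?case using add by (simp add: nn_integral_add distrib_left ac_simps)
next
  case (seq U)
  note [measurable_cong] = sets
  note [measurable] = seq(1)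
  have *: "(\<integral>\<^sup>+x. (SUP i. U i) x \<partial>N) = (SUP i. \<integral>\<^sup>+x. U i x \<partial>N)" if "sets N = sets borel" for N :: "real measure"
  proof -
    note [measurable_cong] = that
    show ?thesis
      using nn_integral_monotone_convergence_SUP[of U N] seq(1) \<open>incseq U\<close> by (simp add: image_comp)
  qed
  have inc: "incseq (\<lambda>i. ennreal k * (\<integral>\<^sup>+x. U i x \<partial>N))" for k and N :: "real measure"
    using \<open>incseq U\<close> by (auto simp: incseq_def le_fun_def intro!: mult_left_mono nn_integral_mono)
  have "(SUP i. \<integral>\<^sup>+x. U i x \<partial>M) = (SUP i. (ennreal a * (\<integral>\<^sup>+x. U i x \<partial>N1) + ennreal b * (\<integral>\<^sup>+x. U i x \<partial>N2))
           + ennreal c * (\<integral>\<^sup>+x. U i x \<partial>N3))"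
    using seq by simp
  also have "\<dots> = (SUP i. (ennreal a * (\<integral>\<^sup>+x. U i x \<partial>N1) + ennreal b * (\<integral>\<^sup>+x. U i x \<partial>N2)))
           + (SUP i. ennreal c * (\<integral>\<^sup>+x. U i x \<partial>N3))"
  proof (rule ennreal_SUP_add[OF _ inc])
    show "incseq (\<lambda>i. ennreal a * (\<integral>\<^sup>+x. U i x \<partial>N1) + ennreal b * (\<integral>\<^sup>+x. U i x \<partial>N2))"
      using inc[of a N1] inc[of b N2] by (auto simp: incseq_def intro!: add_mono)
  qed
  also have "(SUP i. (ennreal a * (\<integral>\<^sup>+x. U i x \<partial>N1) + ennreal b * (\<integral>\<^sup>+x. U i x \<partial>N2)))
     = (SUP i. ennreal a * (\<integral>\<^sup>+x. U i x \<partial>N1)) + (SUP i. ennreal b * (\<integral>\<^sup>+x. U i x \<partial>N2))"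
    by (rule ennreal_SUP_add[OF inc inc])
  finally show ?case by (simp only: *[OF sets(1)] *[OF sets(2)] *[OF sets(3)] *[OF sets(4)] SUP_mult_left_ennreal)
qed

text \<open>Almost sure concentration on [l, u] is the usable form of compact support: continuous
  functions are bounded there, hence integrable, and integrals can be compared from pointwise bounds
  on [l, u].\<close>

locale interval_prob = prob_space M for M :: "real measure" +
  fixes l u :: real
  assumes sets_eq [measurable_cong]: "sets M = sets borel" 
    and AE_interval: "AE x in M. l \<le> x \<and> x \<le> u"
begin

lemma integrable_continuous:
  fixes f :: "real \<Rightarrow> real"
  assumes "continuous_on UNIV f" shows "integrable M f"
proof -
  have "compact (f ` {l..u})"
    by (intro compact_continuous_image continuous_on_subset[OF assms]) auto
  then obtain B where B: "\<And>y. y \<in> f ` {l..u} \<Longrightarrow> norm y \<le> B"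
    by (meson compact_imp_bounded bounded_iff)
  have [measurable]: "f \<in> borel_measurable borel"
    using assms by (rule borel_measurable_continuous_onI)
  have "AE x in M. norm (f x) \<le> B"
    using AE_interval by eventually_elim (use B in auto)
  then show ?thesis by (intro integrable_const_bound) auto
qed

lemma integral_ge_const:
  fixes f :: "real \<Rightarrow> real"
  assumes "continuous_on UNIV f" "\<And>x. l \<le> x \<Longrightarrow> x \<le> u \<Longrightarrow> c \<le> f x"
  shows "c \<le> (LINT x|M. f x)"
proof -
  have "(LINT x|M. c) \<le> (LINT x|M. f x)"
    using AE_interval assms by (intro integral_mono_AE integrable_continuous) auto
  then show ?thesis by (simp add: prob_space)
qed

lemma integral_mono_interval:
  fixes f g :: "real \<Rightarrow> real"
  assumes "continuous_on UNIV f" "continuous_on UNIV g" "\<And>x. l \<le> x \<Longrightarrow> x \<le> u \<Longrightarrow> f x \<le> g x"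
  shows "(LINT x|M. f x) \<le> (LINT x|M. g x)"
  using AE_interval assms by (intro integral_mono_AE integrable_continuous) auto

lemma Err_le_interval:
  assumes "finite A" "A \<noteq> {}" "finite B" "B \<noteq> {}"
    and "\<And>x. l \<le> x \<Longrightarrow> x \<le> u \<Longrightarrow> sqdist A x \<le> sqdist B x"
  shows "Err M A \<le> Err M B"
  unfolding Err_def by (rule integral_mono_interval) (use assms in \<open>auto intro: continuous_sqdist\<close>)

lemma Err_antimono:
  assumes "finite B" "A \<subseteq> B" "A \<noteq> {}" shows "Err M B \<le> Err M A"
  by (rule Err_le_interval) (use assms in \<open>auto intro: sqdist_mono finite_subset\<close>)

lemma Err_affine:
  assumes "finite A" "A \<noteq> {}" "c > 0"
  shows "(LINT x|M. sqdist A (c * x + d)) = c\<^sup>2 * Err M ((\<lambda>y. (y - d) / c) ` A)"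
  using assms by (simp add: sqdist_affine Err_def)

end

text \<open>Nonnegativity of \<open>f\<close> lets the identity pass through \<open>ennreal\<close>;
  the integrands of interest are squared distances.\<close>

lemma integral_mixture:
  fixes f :: "real \<Rightarrow> real" and M N1 N2 N3 :: "real measure"
  assumes "interval_prob M l u" "interval_prob N1 l1 u1" "interval_prob N2 l2 u2" "interval_prob N3 l3 u3"
    and nn: "0 \<le> a" "0 \<le> b" "0 \<le> c"
    and eq: "\<And>X. X \<in> sets borel \<Longrightarrow> measure M X = a * measure (distr N1 borel g1) X 
       + b * measure (distr N2 borel g2) X + c * measure (distr N3 borel g3) X"
    and f: "continuous_on UNIV f" and f0: "\<And>x. 0 \<le> f x"
    and g: "continuous_on UNIV g1" "continuous_on UNIV g2" "continuous_on UNIV g3"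
  shows "(LINT x|M. f x) = a * (LINT x|N1. f (g1 x)) + b * (LINT x|N2. f (g2 x)) + c * (LINT x|N3. f (g3 x))"
proof -
  interpret M: interval_prob M l u by fact
  interpret N1: interval_prob N1 l1 u1 by fact
  interpret N2: interval_prob N2 l2 u2 by fact
  interpret N3: interval_prob N3 l3 u3 by fact
  have fg: "continuous_on UNIV (\<lambda>x. f (g x))" if "continuous_on UNIV g" for g :: "real \<Rightarrow> real"
    using continuous_on_compose2[OF f that] by simp
  have [measurable]: "f \<in> borel_measurable borel" "g1 \<in> borel_measurable borel" "g2 \<in> borel_measurable borel"
    "g3 \<in> borel_measurable borel"
    using f g by (auto intro: borel_measurable_continuous_onI)
  have "(\<integral>\<^sup>+x. ennreal (f x) \<partial>M) = ennreal a * (\<integral>\<^sup>+x. ennreal (f x) \<partial>distr N1 borel g1) 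
      + ennreal b * (\<integral>\<^sup>+x. ennreal (f x) \<partial>distr N2 borel g2)
           + ennreal c * (\<integral>\<^sup>+x. ennreal (f x) \<partial>distr N3 borel g3)"
    by (rule nn_integral_mixture)
      (use nn eq M.sets_eq in \<open>auto intro!: M.finite_measure_axioms N1.finite_measure_distr N2.finite_measure_distr N3.finite_measure_distr\<close>)
  also have "\<dots> = ennreal a * (\<integral>\<^sup>+x. ennreal (f (g1 x)) \<partial>N1) 
      + ennreal b * (\<integral>\<^sup>+x. ennreal (f (g2 x)) \<partial>N2)
           + ennreal c * (\<integral>\<^sup>+x. ennreal (f (g3 x)) \<partial>N3)"
    by (simp add: nn_integral_distr)
  finally have "ennreal (LINT x|M. f x) = ennreal (a * (LINT x|N1. f (g1 x)) + b * (LINT x|N2. f (g2 x)) 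
        + c * (LINT x|N3. f (g3 x)))"
    using nn f0 by (simp add: nn_integral_eq_integral M.integrable_continuous N1.integrable_continuous
        N2.integrable_continuous N3.integrable_continuous f g fg ennreal_mult)
  then show ?thesis
    using nn f0 by (subst (asm) ennreal_inj) (auto intro!: add_nonneg_nonneg mult_nonneg_nonneg integral_nonneg_AE)
qed

subsection \<open>The two measures as mixtures of their images\<close>

text \<open>Iterating \<open>exp\<close> bounds the mass outside the r-neighbourhood of [l, u] by
  the mass outside the (c^k * r)-neighbourhood, which tends to 0 because these sets decrease to the
  empty set. Then r tends to 0 along 1 / (n + 1).\<close>

lemma AE_interval_of_expanding:
  fixes M :: "real measure"
  assumes "prob_space M" and sets: "sets M = sets borel" and "c > 1"
    and exp: "\<And>r. r > 0 \<Longrightarrow> measure M {x. x < l - r \<or> u + r < x} \<le> measure M {x. x < l - c * r \<or> u + c * r < x}"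
  shows "AE x in M. l \<le> x \<and> x \<le> u"
proof -
  interpret prob_space M by fact
  note [measurable_cong] = sets
  define X where "X r = {x. x < l - r \<or> u + r < x}" for r :: real
  have X_sets: "X r \<in> sets M" for r
    unfolding sets X_def by measurable
  have null: "measure M (X r) = 0" if "r > 0" for r
  proof -
    have le: "measure M (X r) \<le> measure M (X (c ^ k * r))" for k
    proof (induction k)
      case (Suc k)
      then show ?case using exp[of "c ^ k * r"] \<open>r > 0\<close> \<open>c > 1\<close> by (simp add: X_def mult.assoc)
    qed simp
    have lim: "filterlim (\<lambda>k. c ^ k * r) at_top sequentially"
    proof -
      have "filterlim (\<lambda>k. c ^ k) at_top sequentially"
        using \<open>c > 1\<close> by real_asymp
      from filterlim_tendsto_pos_mult_at_top[OF tendsto_const \<open>r > 0\<close> this] show ?thesis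
        by (simp add: mult.commute)
    qed
    have dec: "decseq (\<lambda>k. X (c ^ k * r))"
    proof (rule decseq_SucI, rule subsetI)
      fix k x assume "x \<in> X (c ^ Suc k * r)"
      moreover have "c ^ k * r \<le> c ^ Suc k * r"
        using \<open>r > 0\<close> \<open>c > 1\<close> by (simp add: mult.assoc)
      ultimately show "x \<in> X (c ^ k * r)" by (auto simp: X_def)
    qed
    have empty: "(\<Inter>k. X (c ^ k * r)) = {}"
    proof (rule ccontr)
      assume "(\<Inter>k. X (c ^ k * r)) \<noteq> {}"
      then obtain x where x: "\<And>k. x \<in> X (c ^ k * r)" by auto
      have "eventually (\<lambda>k. c ^ k * r > max (l - x) (x - u)) sequentially"
        using lim unfolding filterlim_at_top_dense by blast
      then obtain k where "c ^ k * r > max (l - x) (x - u)"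
        by (auto simp: eventually_sequentially)
      then show False using x[of k] by (auto simp: X_def)
    qed
    have "(\<lambda>k. measure M (X (c ^ k * r))) \<longlonglongrightarrow> measure M (\<Inter>k. X (c ^ k * r))"
      by (rule finite_Lim_measure_decseq) (use X_sets dec in auto)
    then have "measure M (X r) \<le> 0"
      unfolding empty using le by (intro LIMSEQ_le_const) auto
    then show ?thesis by (simp add: measure_nonneg antisym)
  qed
  have "AE x in M. x \<notin> X (1 / real (Suc n))" for n
    by (rule AE_not_in) (use X_sets null in \<open>auto simp: null_sets_def emeasure_eq_measure\<close>)
  then have "AE x in M. \<forall>n. x \<notin> X (1 / real (Suc n))"
    by (subst AE_all_countable) auto
  then show ?thesis
  proof eventually_elim
    case (elim x)
    have "l - x \<le> e" if "e > 0" for e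
    proof -
      obtain n where "1 / real (Suc n) < e" using reals_Archimedean[OF \<open>e > 0\<close>] by (auto simp: inverse_eq_divide)
      then show ?thesis using elim[rule_format, of n] by (auto simp: X_def)
    qed
    moreover have "x - u \<le> e" if "e > 0" for e
    proof -
      obtain n where "1 / real (Suc n) < e" using reals_Archimedean[OF \<open>e > 0\<close>] by (auto simp: inverse_eq_divide)
      then show ?thesis using elim[rule_format, of n] by (auto simp: X_def)
    qed
    ultimately have "l - x \<le> 0" "x - u \<le> 0"
      using field_le_epsilon[of "l - x" 0] field_le_epsilon[of "x - u" 0] by auto
    then show ?case by simp
  qed
qed

text \<open>2/5 and 3/5 are the fixed points of \<open>T1\<close> and \<open>T2\<close>, so the
  inverse maps push points outside the interval away from it by a factor of at least 3.\<close>

lemma interval_prob_nu: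
  assumes "prob_space \<nu>" and sets: "sets \<nu> = sets borel" and ss: "self_similar_nu \<nu>"
  shows "interval_prob \<nu> (2/5) (3/5)"
proof -
  interpret prob_space \<nu> by fact
  note [measurable_cong] = sets
  have [measurable]: "T1 \<in> borel_measurable borel" "T2 \<in> borel_measurable borel"
    unfolding T1_def T2_def by measurable
  have "AE x in \<nu>. 2/5 \<le> x \<and> x \<le> 3/5"
  proof (rule AE_interval_of_expanding[where c = 3])
    fix r :: real assume "r > 0"
    define X where "X r = {x. x < 2/5 - r \<or> 3/5 + r < x}" for r :: real
    have X_sets [measurable]: "X r \<in> sets borel" for r
      unfolding X_def by measurable
    have "measure \<nu> (X r) = 1/2 * measure \<nu> (T1 -` X r \<inter> space \<nu>) + 1/2 * measure \<nu> (T2 -` X r \<inter> space \<nu>)"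
    proof -
      have "T1 \<in> measurable \<nu> borel" "T2 \<in> measurable \<nu> borel" by measurable
      then show ?thesis
        using bspec[OF ss[unfolded self_similar_nu_def] X_sets[of r]] by (simp only: measure_distr[OF _ X_sets])
    qed
    also have "\<dots> \<le> 1/2 * measure \<nu> (X (3 * r)) + 1/2 * measure \<nu> (X (3 * r))"
    proof (intro add_mono mult_left_mono finite_measure_mono)
      show "T1 -` X r \<inter> space \<nu> \<subseteq> X (3 * r)" "T2 -` X r \<inter> space \<nu> \<subseteq> X (3 * r)"
        using \<open>r > 0\<close> by (auto simp: X_def T1_def T2_def)
    qed auto
    finally show "measure \<nu> {x. x < 2/5 - r \<or> 3/5 + r < x} \<le> measure \<nu> {x. x < 2/5 - 3 * r \<or> 3/5 + 3 * r < x}"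
      by (simp add: X_def)
  qed (use assms in auto)
  then show ?thesis using assms by (simp add: interval_prob_def interval_prob_axioms_def)
qed

text \<open>The same argument with the fixed points 0 and 1 of \<open>S1\<close> and
  \<open>S2\<close> and the factor 5; the term of \<open>\<nu>\<close> vanishes because [2/5, 3/5]
  lies inside [0, 1].\<close>

lemma interval_prob_P:
  assumes "prob_space P" and sets: "sets P = sets borel" and ss: "condensation_identity \<nu> P" 
    and nu: "interval_prob \<nu> (2/5) (3/5)"
  shows "interval_prob P 0 1"
proof -
  interpret prob_space P by fact
  interpret nu: interval_prob \<nu> "2/5" "3/5" by fact
  note [measurable_cong] = sets
  have [measurable]: "S1 \<in> borel_measurable borel" "S2 \<in> borel_measurable borel"
    unfolding S1_def S2_def by measurable
  have "AE x in P. 0 \<le> x \<and> x \<le> 1"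
  proof (rule AE_interval_of_expanding[where c = 5])
    fix r :: real assume "r > 0"
    define X where "X r = {x. x < 0 - r \<or> 1 + r < x}" for r :: real
    have X_sets [measurable]: "X r \<in> sets borel" for r
      unfolding X_def by measurable
    have "AE x in \<nu>. x \<notin> X r"
      using nu.AE_interval by eventually_elim (use \<open>r > 0\<close> in \<open>auto simp: X_def\<close>)
    then have nu0: "measure \<nu> (X r) = 0"
      using X_sets[of r] by (subst nu.prob_eq_0) (auto simp: nu.sets_eq)
    have "measure P (X r) = 1/3 * measure P (S1 -` X r \<inter> space P) + 1/3 * measure P (S2 -` X r \<inter> space P)"
    proof -
      have "S1 \<in> measurable P borel" "S2 \<in> measurable P borel" by measurable
      then show ?thesis
        using bspec[OF ss[unfolded condensation_identity_def] X_sets[of r]] nu0 by (simp only: measure_distr[OF _ X_sets])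
    qed
    also have "\<dots> \<le> 1/3 * measure P (X (5 * r)) + 1/3 * measure P (X (5 * r))"
    proof (intro add_mono mult_left_mono finite_measure_mono)
      show "S1 -` X r \<inter> space P \<subseteq> X (5 * r)" "S2 -` X r \<inter> space P \<subseteq> X (5 * r)"
        using \<open>r > 0\<close> by (auto simp: X_def S1_def S2_def)
    qed auto
    also have "\<dots> \<le> measure P (X (5 * r))" by simp
    finally show "measure P {x. x < 0 - r \<or> 1 + r < x} \<le> measure P {x. x < 0 - 5 * r \<or> 1 + 5 * r < x}"
      by (simp add: X_def)
  qed (use assms in auto)
  then show ?thesis using assms by (simp add: interval_prob_def interval_prob_axioms_def)
qed

lemma integral_nu:
  fixes f :: "real \<Rightarrow> real"
  assumes nu: "interval_prob \<nu> l u" and ss: "self_similar_nu \<nu>"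
    and f: "continuous_on UNIV f" "\<And>x. 0 \<le> f x"
  shows "(LINT x|\<nu>. f x) = 1/2 * (LINT x|\<nu>. f (T1 x)) + 1/2 * (LINT x|\<nu>. f (T2 x))"
  using integral_mixture[OF nu nu nu nu, of "1/2" "1/2" 0 T1 T2 id f] f ss
  by (simp add: self_similar_nu_def T1_def[abs_def] T2_def[abs_def] continuous_intros)

lemma integral_P:
  fixes f :: "real \<Rightarrow> real"
  assumes nu: "interval_prob \<nu> l u" and P: "interval_prob P l' u'" and ss: "condensation_identity \<nu> P"
    and f: "continuous_on UNIV f" "\<And>x. 0 \<le> f x"
  shows "(LINT x|P. f x) = 1/3 * (LINT x|P. f (S1 x)) + 1/3 * (LINT x|P. f (S2 x)) + 1/3 * (LINT x|\<nu>. f x)"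
proof -
  interpret nu: interval_prob \<nu> l u by fact
  have "distr \<nu> borel (\<lambda>x. x) = \<nu>"
    by (rule distr_id2) (simp add: nu.sets_eq)
  then show ?thesis
    using integral_mixture[OF P P P nu, of "1/3" "1/3" "1/3" S1 S2 "\<lambda>x. x" f] f ss
    by (simp add: condensation_identity_def S1_def[abs_def] S2_def[abs_def] continuous_intros)
qed

section \<open>The Cantor measure in centred coordinates\<close>

locale cantor = interval_prob M "-1" 1 for M :: "real measure" +
  assumes integral_halves: "\<And>f :: real \<Rightarrow> real. continuous_on UNIV f \<Longrightarrow> (\<And>x. 0 \<le> f x) \<Longrightarrow>
    (LINT x|M. f x) = 1/2 * (LINT x|M. f (x/3 - 2/3)) + 1/2 * (LINT x|M. f (x/3 + 2/3))"

text \<open>The map 10 * x - 5 carries [2/5, 3/5] onto [-1, 1] and conjugates \<open>T1\<close>,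
  \<open>T2\<close> to x/3 - 2/3 and x/3 + 2/3, which negation exchanges.\<close>

lemma cantor_nu:
  assumes "interval_prob \<nu> (2/5) (3/5)" and ss: "self_similar_nu \<nu>"
  shows "cantor (distr \<nu> borel (\<lambda>x. 10 * x - 5))"
proof -
  interpret nu: interval_prob \<nu> "2/5" "3/5" by fact
  let ?M = "distr \<nu> borel (\<lambda>x. 10 * x - 5)"
  have "prob_space ?M" by (rule nu.prob_space_distr) measurable
  moreover have "AE x in ?M. - 1 \<le> x \<and> x \<le> 1"
  proof (subst AE_distr_iff)
    show "AE x in \<nu>. - 1 \<le> 10 * x - 5 \<and> 10 * x - 5 \<le> 1"
      using nu.AE_interval by eventually_elim auto
  qed auto
  moreover have "(LINT x|?M. f x) = 1/2 * (LINT x|?M. f (x/3 - 2/3)) + 1/2 * (LINT x|?M. f (x/3 + 2/3))"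
    if f: "continuous_on UNIV f" "\<And>x. 0 \<le> f x" for f :: "real \<Rightarrow> real"
  proof -
    have [measurable]: "f \<in> borel_measurable borel"
      using f(1) by (rule borel_measurable_continuous_onI)
    have "continuous_on UNIV (\<lambda>x. f (10 * x - 5))"
      by (rule continuous_on_compose2[OF f(1)]) (auto intro!: continuous_intros)
    moreover have "10 * T1 x - 5 = (10 * x - 5) / 3 - 2/3" "10 * T2 x - 5 = (10 * x - 5) / 3 + 2/3" for x
      by (simp_all add: T1_def T2_def field_simps)
    ultimately show ?thesis
      using integral_nu[OF assms, of "\<lambda>x. f (10 * x - 5)"] f(2) by (simp add: integral_distr)
  qed
  ultimately show ?thesis
    by (simp add: cantor_def cantor_axioms_def interval_prob_def interval_prob_axioms_def)
qed

text \<open>Symmetry of \<open>M\<close> itself would require uniqueness of the self-similar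
  measure. It is enough that the reflected measure is another instance of the locale, so that bounds
  proved for all instances can be reflected.\<close>

lemma cantor_reflect:
  assumes "cantor M" shows "cantor (distr M borel uminus)"
proof -
  interpret cantor M by fact
  let ?M = "distr M borel (uminus :: real \<Rightarrow> real)"
  have "prob_space ?M" by (rule prob_space_distr) measurable
  moreover have "AE x in ?M. - 1 \<le> x \<and> x \<le> 1"
  proof (subst AE_distr_iff)
    show "AE x in M. - 1 \<le> - x \<and> - x \<le> 1"
      using AE_interval by eventually_elim auto
  qed auto
  moreover have "(LINT x|?M. f x) = 1/2 * (LINT x|?M. f (x/3 - 2/3)) + 1/2 * (LINT x|?M. f (x/3 + 2/3))"
    if f: "continuous_on UNIV f" "\<And>x. 0 \<le> f x" for f :: "real \<Rightarrow> real"
  proof -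
    have [measurable]: "f \<in> borel_measurable borel"
      using f(1) by (rule borel_measurable_continuous_onI)
    have "continuous_on UNIV (\<lambda>x. f (- x))"
      by (rule continuous_on_compose2[OF f(1)]) (auto intro!: continuous_intros)
    moreover have "- (x / 3 - 2/3) = - x / 3 + 2/3" "- (x / 3 + 2/3) = - x / 3 - 2/3" for x :: real
      by auto
    ultimately show ?thesis
      using integral_halves[of "\<lambda>x. f (- x)"] f(2) by (simp add: integral_distr)
  qed
  ultimately show ?thesis
    by (simp add: cantor_def cantor_axioms_def interval_prob_def interval_prob_axioms_def)
qed

context cantor
begin

text \<open>The mean \<open>g\<close> and second moment \<open>m\<close> come from self-similarity.
  As \<open>integral_halves\<close> accepts only nonnegative integrands, it is applied to the
  squared distance to \<open>a\<close>, giving a linear equation in \<open>g\<close> and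
  \<open>m\<close> for each \<open>a\<close>: \<open>a = 0\<close> yields \<open>m = 1/2\<close>,
  then \<open>a = 1\<close> yields \<open>g = 0\<close>.\<close>

lemma Err_singleton: "Err M {a} = 1/2 + a\<^sup>2"
proof -
  define g where "g = (LINT x|M. x)"
  define m where "m = (LINT x|M. x\<^sup>2)"
  have E: "(LINT x|M. (x - a)\<^sup>2) = m - 2 * a * g + a\<^sup>2" for a
  proof -
    have "(LINT x|M. (x - a)\<^sup>2) = (LINT x|M. x\<^sup>2 - 2 * a * x + a\<^sup>2)"
      by (simp add: power2_diff algebra_simps)
    also have "\<dots> = (LINT x|M. x\<^sup>2) - (LINT x|M. 2 * a * x) + (LINT x|M. a\<^sup>2)"
      by (subst Bochner_Integration.integral_add Bochner_Integration.integral_diff 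
          | intro Bochner_Integration.integrable_diff integrable_continuous continuous_intros refl)+
    finally show ?thesis by (simp add: g_def m_def prob_space)
  qed
  have step: "m - 2 * a * g + a\<^sup>2 = 1/18 * (m - 2 * (3 * a + 2) * g + (3 * a + 2)\<^sup>2) + 1/18 * (m - 2 * (3 * a - 2) * g + (3 * a - 2)\<^sup>2)" for a
  proof -
    have *: "(x / 3 - 2/3 - a)\<^sup>2 = 1/9 * (x - (3 * a + 2))\<^sup>2" "(x / 3 + 2/3 - a)\<^sup>2 = 1/9 * (x - (3 * a - 2))\<^sup>2" for x
      by (simp_all add: power2_eq_square field_simps)
    have "continuous_on UNIV (\<lambda>x. (x - a)\<^sup>2)" by (intro continuous_intros)
    then have "(LINT x|M. (x - a)\<^sup>2) = 1/2 * (LINT x|M. (x/3 - 2/3 - a)\<^sup>2) + 1/2 * (LINT x|M. (x/3 + 2/3 - a)\<^sup>2)"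
      by (rule integral_halves) auto
    then show ?thesis unfolding * by (simp add: E)
  qed
  have "m = 1/2" using step[of 0] by (simp add: power2_eq_square field_simps)
  moreover have "g = 0" using step[of 1] \<open>m = 1/2\<close> by (simp add: power2_eq_square field_simps)
  ultimately show ?thesis using E[of a] by (simp add: Err_def)
qed

text \<open>The eight constants belong to the cylinder intervals of level three, from left to right.\<close>

lemma integral_ge_eighths:
  fixes f :: "real \<Rightarrow> real"
  assumes f: "continuous_on UNIV f" "\<And>x. 0 \<le> f x"
    and "\<And>x. -1 \<le> x \<Longrightarrow> x \<le> -25/27 \<Longrightarrow> c1 \<le> f x"
    and "\<And>x. -23/27 \<le> x \<Longrightarrow> x \<le> -7/9 \<Longrightarrow> c2 \<le> f x"
    and "\<And>x. -5/9 \<le> x \<Longrightarrow> x \<le> -13/27 \<Longrightarrow> c3 \<le> f x"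
    and "\<And>x. -11/27 \<le> x \<Longrightarrow> x \<le> -1/3 \<Longrightarrow> c4 \<le> f x"
    and "\<And>x. 1/3 \<le> x \<Longrightarrow> x \<le> 11/27 \<Longrightarrow> c5 \<le> f x"
    and "\<And>x. 13/27 \<le> x \<Longrightarrow> x \<le> 5/9 \<Longrightarrow> c6 \<le> f x"
    and "\<And>x. 7/9 \<le> x \<Longrightarrow> x \<le> 23/27 \<Longrightarrow> c7 \<le> f x"
    and "\<And>x. 25/27 \<le> x \<Longrightarrow> x \<le> 1 \<Longrightarrow> c8 \<le> f x"
  shows "(c1 + c2 + c3 + c4 + c5 + c6 + c7 + c8) / 8 \<le> (LINT x|M. f x)"
proof -
  \<comment> \<open>For the parameters that occur, this is the mean of \<open>f\<close> over the
    cylinder with centre \<open>m\<close> and half-length \<open>h\<close>.\<close>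
  define J where "J h m = (LINT x|M. f (h * x + m))" for h m
  have cont: "continuous_on UNIV (\<lambda>x. f (h * x + m))" for h m
    by (rule continuous_on_compose2[OF f(1)]) (auto intro!: continuous_intros)
  have halves: "(c + d) / 2 \<le> J h m" if "c \<le> J h' m1" "d \<le> J h' m2" 
    "h' = h / 3" "m1 = m - 2 * h / 3" "m2 = m + 2 * h / 3" for c d h m h' m1 m2
  proof -
    have "h' * x + m1 = h * (x/3 - 2/3) + m" "h' * x + m2 = h * (x/3 + 2/3) + m" for x
      using that(3-5) by (auto simp: field_simps)
    then have "J h m = 1/2 * J h' m1 + 1/2 * J h' m2"
      using integral_halves[OF cont, of h m] f(2) by (simp add: J_def)
    then show ?thesis using that(1,2) by simp
  qed
  have leaf: "c \<le> J (1/27) m" if "\<And>x. m - 1/27 \<le> x \<Longrightarrow> x \<le> m + 1/27 \<Longrightarrow> c \<le> f x" for c m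
    unfolding J_def by (rule integral_ge_const[OF cont]) (rule that; simp)
  have *: "c1 \<le> J (1/27) (-26/27)" "c2 \<le> J (1/27) (-22/27)" "c3 \<le> J (1/27) (-14/27)" "c4 \<le> J (1/27) (-10/27)"
    "c5 \<le> J (1/27) (10/27)" "c6 \<le> J (1/27) (14/27)" "c7 \<le> J (1/27) (22/27)" "c8 \<le> J (1/27) (26/27)"
    by (rule leaf, rule assms; simp)+
  have "(c1 + c2) / 2 \<le> J (1/9) (-8/9)" "(c3 + c4) / 2 \<le> J (1/9) (-4/9)" 
     "(c5 + c6) / 2 \<le> J (1/9) (4/9)" "(c7 + c8) / 2 \<le> J (1/9) (8/9)"
    by (rule halves, rule *, rule *, simp, simp, simp)+
  note ** = this
  have "((c1 + c2) / 2 + (c3 + c4) / 2) / 2 \<le> J (1/3) (-2/3)" "((c5 + c6) / 2 + (c7 + c8) / 2) / 2 \<le> J (1/3) (2/3)"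
    by (rule halves, rule **, rule **, simp, simp, simp)+
  then have "(((c1 + c2) / 2 + (c3 + c4) / 2) / 2 + ((c5 + c6) / 2 + (c7 + c8) / 2) / 2) / 2 \<le> J 1 0"
    by (rule halves) simp_all
  then show ?thesis by (simp add: J_def field_simps)
qed

end

subsection \<open>The rescaled Cantor measure\<close>

context cantor
begin

text \<open>A point \<open>a \<le> 0\<close> that is nearest to some point of the right half keeps the interval
  between \<open>a\<close> and \<open>2/3 - a\<close> free of other points.\<close>

lemma Err_straddling_left:
  assumes A: "finite A" and a: "a \<in> A" "a \<le> 0" and gap: "\<And>b. b \<in> A \<Longrightarrow> b \<le> a \<or> 2/3 - a \<le> b"
  shows "29/2916 \<le> Err M A" "card A \<le> 2 \<Longrightarrow> 1/18 \<le> Err M A"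
proof -
  have ne: "A \<noteq> {}" using a by auto
  have cont: "continuous_on UNIV (sqdist A)" by (rule continuous_sqdist) fact+
  have nn: "0 \<le> sqdist A x" for x by (rule sqdist_nonneg) fact+
  have ge: "d\<^sup>2 \<le> sqdist A x" if "0 \<le> d" "\<And>b. b \<in> A \<Longrightarrow> d \<le> \<bar>x - b\<bar>" for d x
    using that by (intro sqdist_geI A ne) (metis power2_abs power_mono)
  note eighths = integral_ge_eighths[OF cont nn, folded Err_def]
  \<comment> \<open>As \<open>a \<le> 0\<close>, no point lies strictly between 0 and 2/3. The
    numbers 7/27 and 1/9 are the distances from the cylinders [1/3, 11/27] and [13/27, 5/9] to
    2/3.\<close>
  have "(0 + 0 + 0 + 0 + (7/27)\<^sup>2 + (1/9)\<^sup>2 + 0 + 0) / 8 \<le> Err M A"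
    by (rule eighths; (rule ge | rule nn)) (use a gap in force)+
  then show "29/2916 \<le> Err M A" by (simp add: power2_eq_square)
  show "1/18 \<le> Err M A" if "card A \<le> 2"
  proof (cases "\<forall>b\<in>A. b \<le> a")
    case True
    have "(0 + 0 + 0 + 0 + (1/3)\<^sup>2 + (1/3)\<^sup>2 + (1/3)\<^sup>2 + (1/3)\<^sup>2) / 8 \<le> Err M A"
      by (rule eighths; (rule ge | rule nn)) (use a True in force)+
    then show ?thesis by (simp add: power2_eq_square)
  next
    case False
    then obtain b where b: "b \<in> A" "b > a" by auto
    then have "{a, b} = A" using a A that by (intro card_seteq) auto
    then have Aab: "A = {a, b}" by simp
    have b': "b \<ge> 2/3 - a" using b gap by force
    \<comment> \<open>If \<open>a \<ge> -1/3\<close>, both points lie to the right of the left half,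
      and distances are measured to -1/3. Otherwise \<open>b\<close> exceeds 1, and the first two
      cylinders of the right half are far from both points.\<close>
    show ?thesis
    proof (cases "a \<ge> -1/3")
      case True
      have "((16/27)\<^sup>2 + (4/9)\<^sup>2 + (4/27)\<^sup>2 + 0 + 0 + 0 + 0 + 0) / 8 \<le> Err M A"
        by (rule eighths; (rule ge | rule nn)) (use True b' a Aab in force)+
      then show ?thesis by (simp add: power2_eq_square)
    next
      case False
      have "(0 + 0 + 0 + 0 + (16/27)\<^sup>2 + (4/9)\<^sup>2 + 0 + 0) / 8 \<le> Err M A"
        by (rule eighths; (rule ge | rule nn)) (use False b' a Aab in force)+
      then show ?thesis by (simp add: power2_eq_square)
    qed
  qed
qed

end

text \<open>No point of \<open>A\<close> is strictly nearer to \<open>x\<close> than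
  \<open>a\<close>, so the interval from \<open>a\<close> to its mirror image 2 * x - a is free, and
  2 * x - a is at least 2/3 - a.\<close>

lemma nearest_gap:
  assumes "finite A" "a \<le> 0" "x \<ge> 1/3" "sqdist A x = (x - a)\<^sup>2" "b \<in> A"
  shows "b \<le> a \<or> 2/3 - a \<le> b"
proof -
  have "(x - a)\<^sup>2 \<le> (x - b)\<^sup>2" using sqdist_le[of A b x] assms by simp
  then have "\<bar>x - a\<bar> \<le> \<bar>x - b\<bar>" by (simp add: abs_le_square_iff)
  then show ?thesis using assms by (auto simp: abs_if split: if_splits)
qed

lemma sqdist_uminus:
  shows "sqdist (uminus ` A) x = sqdist A (- x)"
proof -
  have "(x + a)\<^sup>2 = (- x - a)\<^sup>2" for a by (simp add: power2_eq_square algebra_simps)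
  then show ?thesis by (simp add: sqdist_def image_image)
qed

lemma (in interval_prob) Err_uminus:
  assumes "finite A" "A \<noteq> {}"
  shows "Err (distr M borel uminus) (uminus ` A) = Err M A"
proof -
  have [measurable]: "sqdist (uminus ` A) \<in> borel_measurable borel"
    by (intro borel_measurable_continuous_onI continuous_sqdist) (use assms in auto)
  show ?thesis unfolding Err_def by (subst integral_distr) (simp_all add: sqdist_uminus)
qed

context cantor
begin

text \<open>A point used by both halves lies on the wrong side of 0 for one of them. For
  \<open>a \<le> 0\<close> the witness \<open>x2\<close> gives the gap; for \<open>a > 0\<close> the
  reflected measure is used with the witness \<open>- x1\<close>.\<close>

lemma Err_straddling:
  assumes A: "finite A" and a: "a \<in> A" 
    and x: "x1 \<le> -1/3" "sqdist A x1 = (x1 - a)\<^sup>2" "1/3 \<le> x2" "sqdist A x2 = (x2 - a)\<^sup>2"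
  shows "29/2916 \<le> Err M A \<and> (card A \<le> 2 \<longrightarrow> 1/18 \<le> Err M A)"
proof (cases "a \<le> 0")
  case True
  then show ?thesis
    using Err_straddling_left[OF A a True nearest_gap[OF A True x(3,4)]] by blast
next
  case False
  interpret R: cantor "distr M borel uminus" by (rule cantor_reflect) (rule cantor_axioms)
  have "sqdist (uminus ` A) (- x1) = (- x1 - (- a))\<^sup>2"
    using x(2) by (simp add: sqdist_uminus power2_commute)
  moreover have "- a \<le> 0" "finite (uminus ` A)" "- a \<in> uminus ` A" "1/3 \<le> - x1" 
    using False A a x by auto
  ultimately have "29/2916 \<le> Err (distr M borel uminus) (uminus ` A) \<and> 
      (card (uminus ` A) \<le> 2 \<longrightarrow> 1/18 \<le> Err (distr M borel uminus) (uminus ` A))"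
    using R.Err_straddling_left[of "uminus ` A" "- a"] nearest_gap[of "uminus ` A" "- a" "- x1"] by blast
  moreover have "Err (distr M borel uminus) (uminus ` A) = Err M A"
    using A a by (intro Err_uminus) auto
  moreover have "card (uminus ` A) = card A" by (simp add: card_image)
  ultimately show ?thesis by simp
qed

text \<open>The factor 1/18 is the weight 1/2 times the squared ratio 1/9; the two images are
  \<open>A\<close> in the coordinates of the halves.\<close>

lemma Err_cantor:
  assumes "finite A" "A \<noteq> {}"
  shows "Err M A = 1/18 * (Err M ((\<lambda>y. 3 * y + 2) ` A) + Err M ((\<lambda>y. 3 * y - 2) ` A))"
proof -
  have "Err M A = 1/2 * (LINT x|M. sqdist A (x/3 - 2/3)) + 1/2 * (LINT x|M. sqdist A (x/3 + 2/3))"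
    unfolding Err_def by (rule integral_halves) (use assms in \<open>auto intro: continuous_sqdist sqdist_nonneg\<close>)
  then show ?thesis
    using Err_affine[OF assms, of "1/3" "-2/3"] Err_affine[OF assms, of "1/3" "2/3"] 
    by (simp add: power2_eq_square algebra_simps)
qed

text \<open>Each term of \<open>Err_cantor\<close> looks at one half only, so each may be estimated
  with its own set of points.\<close>

lemma Err_split:
  assumes A1: "finite A1" "A1 \<noteq> {}" and A2: "finite A2" "A2 \<noteq> {}" and A: "finite A" "A \<noteq> {}"
    and le: "\<And>x. -1 \<le> x \<Longrightarrow> x \<le> -1/3 \<Longrightarrow> sqdist A1 x \<le> sqdist A x"
      "\<And>x. 1/3 \<le> x \<Longrightarrow> x \<le> 1 \<Longrightarrow> sqdist A2 x \<le> sqdist A x"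
  shows "1/18 * (Err M ((\<lambda>y. 3 * y + 2) ` A1) + Err M ((\<lambda>y. 3 * y - 2) ` A2)) \<le> Err M A"
proof -
  have aff: "sqdist ((\<lambda>y. 3 * y - 3 * d) ` B) x = 9 * sqdist B (x / 3 + d)" if "finite B" "B \<noteq> {}" for B d x
    using sqdist_affine[OF that, of "1/3" x d] by (simp add: power2_eq_square algebra_simps)
  have "Err M ((\<lambda>y. 3 * y - 3 * (-2/3)) ` A1) \<le> Err M ((\<lambda>y. 3 * y - 3 * (-2/3)) ` A)"
  proof (rule Err_le_interval)
    fix x :: real assume "-1 \<le> x" "x \<le> 1"
    then show "sqdist ((\<lambda>y. 3 * y - 3 * (-2/3)) ` A1) x \<le> sqdist ((\<lambda>y. 3 * y - 3 * (-2/3)) ` A) x"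
      unfolding aff[OF A1] aff[OF A] by (intro mult_left_mono le) auto
  qed (use A A1 in auto)
  moreover have "Err M ((\<lambda>y. 3 * y - 3 * (2/3)) ` A2) \<le> Err M ((\<lambda>y. 3 * y - 3 * (2/3)) ` A)"
  proof (rule Err_le_interval)
    fix x :: real assume "-1 \<le> x" "x \<le> 1"
    then show "sqdist ((\<lambda>y. 3 * y - 3 * (2/3)) ` A2) x \<le> sqdist ((\<lambda>y. 3 * y - 3 * (2/3)) ` A) x"
      unfolding aff[OF A2] aff[OF A] by (intro mult_left_mono le) auto
  qed (use A A2 in auto)
  ultimately show ?thesis by (subst Err_cantor[OF A]) simp
qed

text \<open>If no point of \<open>A\<close> is nearest to points of both halves, \<open>A\<close> splits and self-similarity gives the
  induction step. Otherwise the distortion alone is so large that only \<open>j \<le> 2\<close> needs attention.\<close>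

lemma Err_ge:
  assumes "finite A" "A \<noteq> {}" 
  shows "3/2 / 9 ^ j \<le> Err M A + real (card A) / 18 ^ j"
  using assms
proof (induction j arbitrary: A)
  case (0 A)
  \<comment> \<open>The bound 3/2 is attained by the single point 0 with cost 1/2 + 1; two points
    already pay 2 for themselves.\<close>
  have "card A \<noteq> 0" using 0 by simp
  then consider "card A = 1" | "card A \<ge> 2" by linarith
  then show ?case
  proof cases
    case 1
    then obtain a where "A = {a}" by (auto simp: card_1_singleton_iff)
    then show ?thesis by (simp add: Err_singleton)
  next
    case 2
    then show ?thesis using Err_nonneg[OF 0, of M] by simp
  qed
next
  case (Suc j A)
  \<comment> \<open>The points of \<open>A\<close> that serve the left half, and those that serve
    the right half. Points serving neither are discarded, which only helps the count.\<close>
  define A1 where "A1 = {a \<in> A. \<exists>x. -1 \<le> x \<and> x \<le> -1/3 \<and> sqdist A x = (x - a)\<^sup>2}"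
  define A2 where "A2 = {a \<in> A. \<exists>x. 1/3 \<le> x \<and> x \<le> 1 \<and> sqdist A x = (x - a)\<^sup>2}"
  have fin: "finite A1" "finite A2" using Suc by (auto simp: A1_def A2_def)
  have le1: "sqdist A1 x \<le> sqdist A x \<and> A1 \<noteq> {}" if "-1 \<le> x" "x \<le> -1/3" for x
  proof -
    obtain a where "a \<in> A" "sqdist A x = (x - a)\<^sup>2" using sqdist_attained[OF Suc.prems] .
    moreover from this that have "a \<in> A1" by (auto simp: A1_def)
    ultimately show ?thesis using sqdist_le[OF fin(1), of a x] by auto
  qed
  have le2: "sqdist A2 x \<le> sqdist A x \<and> A2 \<noteq> {}" if "1/3 \<le> x" "x \<le> 1" for x
  proof -
    obtain a where "a \<in> A" "sqdist A x = (x - a)\<^sup>2" using sqdist_attained[OF Suc.prems] .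
    moreover from this that have "a \<in> A2" by (auto simp: A2_def)
    ultimately show ?thesis using sqdist_le[OF fin(2), of a x] by auto
  qed
  have ne: "A1 \<noteq> {}" "A2 \<noteq> {}" using le1[of "-1"] le2[of 1] by auto
  show ?case
  proof (cases "A1 \<inter> A2 = {}")
    case True
    have card: "card A1 + card A2 \<le> card A"
      using True fin Suc.prems by (subst card_Un_disjoint[symmetric]) (auto simp: A1_def A2_def intro!: card_mono)
    define B1 where "B1 = (\<lambda>y. 3 * y + 2 :: real) ` A1"
    define B2 where "B2 = (\<lambda>y. 3 * y - 2 :: real) ` A2"
    have cB: "card B1 = card A1" "card B2 = card A2"
      unfolding B1_def B2_def by (auto intro!: card_image simp: inj_on_def)
    have IH: "3/2 / 9 ^ j \<le> Err M B1 + real (card A1) / 18 ^ j" "3/2 / 9 ^ j \<le> Err M B2 + real (card A2) / 18 ^ j"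
      using Suc.IH[of B1] Suc.IH[of B2] fin ne cB by (auto simp: B1_def B2_def)
    \<comment> \<open>The bound reproduces itself: two halves with factor 1/18 turn 9^-j into
      9^-(j+1), while the price 18^-j becomes 18^-(j+1).\<close>
    have "3/2 / 9 ^ Suc j = 1/18 * (3/2 / 9 ^ j + 3/2 / (9 :: real) ^ j)" by (simp add: field_simps)
    also have "\<dots> \<le> 1/18 * ((Err M B1 + real (card A1) / 18 ^ j) + (Err M B2 + real (card A2) / 18 ^ j))"
      using IH by (intro mult_left_mono add_mono) auto
    also have "\<dots> = 1/18 * (Err M B1 + Err M B2) + real (card A1 + card A2) / 18 ^ Suc j"
      by (simp add: field_simps)
    also have "\<dots> \<le> Err M A + real (card A) / 18 ^ Suc j"
    proof (rule add_mono)
      show "1/18 * (Err M B1 + Err M B2) \<le> Err M A"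
        unfolding B1_def B2_def using Err_split[of A1 A2 A] fin ne Suc.prems le1 le2 by blast
      show "real (card A1 + card A2) / 18 ^ Suc j \<le> real (card A) / 18 ^ Suc j"
        using card by (intro divide_right_mono) (auto simp del: of_nat_add)
    qed
    finally show ?thesis .
  next
    case False
    then obtain a x1 x2 where *: "a \<in> A" "x1 \<le> -1/3" "sqdist A x1 = (x1 - a)\<^sup>2" "1/3 \<le> x2" "sqdist A x2 = (x2 - a)\<^sup>2"
      by (auto simp: A1_def A2_def)
    from Err_straddling[OF Suc.prems(1) this]
    have E: "29/2916 \<le> Err M A" "card A \<le> 2 \<Longrightarrow> 1/18 \<le> Err M A" by auto
    have E1: "1/2 \<le> Err M A" if "card A = 1"
      using that by (auto simp: card_1_singleton_iff Err_singleton)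
    have pos: "card A \<ge> 1" using Suc.prems by (simp add: Suc_le_eq card_gt_0_iff)
    consider "j = 0" | "j = 1" | "j \<ge> 2" by linarith
    then show ?thesis
    proof cases
      case 1
      \<comment> \<open>The target is 1/6, with no room to spare: two points give 1/18 + 2/18, three
        points pay 3/18 by themselves.\<close>
      consider "card A = 1" | "card A = 2" | "card A \<ge> 3" using pos by linarith
      then show ?thesis using 1 E E1 Err_nonneg[OF Suc.prems, of M] by cases auto
    next
      case 2
      consider "card A \<le> 2" | "card A \<ge> 3" by linarith
      then show ?thesis
      proof cases
        case 1
        then show ?thesis using E(2) 2 by (simp add: add_increasing2)
      next
        case 2
        then have "real (card A) \<ge> 3" by simp
        \<comment> \<open>29/2916 + 3/324 = 56/2916 just exceeds the target 1/54 = 54/2916; this is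
          why level-three cylinders are used.\<close>
        then show ?thesis using E(1) \<open>j = 1\<close> by simp
      qed
    next
      case 3
      have "(9::real) ^ 3 \<le> 9 ^ Suc j" using 3 by (intro power_increasing) auto
      then have "3/2 / 9 ^ Suc j \<le> 3/2 / (9::real) ^ 3" by (intro divide_left_mono) auto
      also have "\<dots> \<le> Err M A" using E(1) by simp
      also have "\<dots> \<le> Err M A + real (card A) / 18 ^ Suc j" by simp
      finally show ?thesis .
    qed
  qed
qed

text \<open>Sharp: \<open>pen_cantor_pow_le\<close> with \<open>t = 1\<close> gives the same value
  from above.\<close>

lemma pen_ge_cantor: "3/2 / 9 ^ j \<le> pen M (1 / 18 ^ j)"
  using Err_ge by (intro pen_ge) simp

text \<open>Copying a set into both halves at most doubles its number of points and divides its
  distortion by at least 9.\<close>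

lemma pen_cantor_le: 
  assumes "0 \<le> t" shows "pen M t \<le> 1/9 * pen M (18 * t)"
proof -
  have "9 * pen M t \<le> pen M (18 * t)"
  proof (rule pen_ge)
    fix A :: "real set" assume A: "finite A" "A \<noteq> {}"
    define B1 where "B1 = (\<lambda>x. x / 3 - 2/3) ` A"
    define B2 where "B2 = (\<lambda>x. x / 3 + 2/3) ` A"
    have B: "finite (B1 \<union> B2)" "B1 \<union> B2 \<noteq> {}" using A by (auto simp: B1_def B2_def)
    have "A \<subseteq> (\<lambda>y. 3 * y + 2) ` (B1 \<union> B2)" "A \<subseteq> (\<lambda>y. 3 * y - 2) ` (B1 \<union> B2)"
      by (auto simp: B1_def B2_def image_Un image_image)
    then have "Err M ((\<lambda>y. 3 * y + 2) ` (B1 \<union> B2)) \<le> Err M A" "Err M ((\<lambda>y. 3 * y - 2) ` (B1 \<union> B2)) \<le> Err M A"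
      using B A by (auto intro!: Err_antimono)
    then have E: "Err M (B1 \<union> B2) \<le> 1/9 * Err M A" by (subst Err_cantor[OF B]) simp
    have "card (B1 \<union> B2) \<le> 2 * card A"
      using card_Un_le[of B1 B2] card_image_le[OF A(1), of "\<lambda>x. x / 3 - 2/3"] card_image_le[OF A(1), of "\<lambda>x. x / 3 + 2/3"]
      by (simp add: B1_def B2_def)
    then have "real (card (B1 \<union> B2)) \<le> 2 * real (card A)" by linarith
    then have "t * real (card (B1 \<union> B2)) \<le> t * (2 * real (card A))" using assms by (intro mult_left_mono)
    then show "9 * pen M t \<le> Err M A + 18 * t * real (card A)"
      using pen_le[OF assms B(1,2), of M] E by simp
  qed
  then show ?thesis by simp
qed

lemma pen_cantor_le_add: "0 \<le> t \<Longrightarrow> pen M t \<le> 1/2 + t"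
  using pen_le[of t "{0}" M] by (simp add: Err_singleton)

text \<open>Iterates the copying step from the single point 0, which amounts to the 2^j centres of
  the level-j cylinders.\<close>

lemma pen_cantor_pow_le: "0 \<le> t \<Longrightarrow> pen M (t / 18 ^ j) \<le> (1/2 + t) / 9 ^ j"
proof (induction j)
  case 0
  then show ?case using pen_cantor_le_add by simp
next
  case (Suc j)
  have "pen M (t / 18 ^ Suc j) \<le> 1/9 * pen M (t / 18 ^ j)"
    using pen_cantor_le[of "t / 18 ^ Suc j"] Suc.prems by simp
  also have "\<dots> \<le> 1/9 * ((1/2 + t) / 9 ^ j)" using Suc by (intro mult_left_mono) auto
  finally show ?case by simp
qed

end

subsection \<open>The condensation measure\<close>

locale condensation = P: interval_prob P 0 1 + nu: interval_prob \<nu> "2/5" "3/5" + M: cantor M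
  for P \<nu> M :: "real measure" +
  assumes integral_thirds: "\<And>f :: real \<Rightarrow> real. continuous_on UNIV f \<Longrightarrow> (\<And>x. 0 \<le> f x) \<Longrightarrow>
      (LINT x|P. f x) = 1/3 * (LINT x|P. f (x/5)) + 1/3 * (LINT x|P. f (x/5 + 4/5)) + 1/3 * (LINT x|\<nu>. f x)"
    and M_eq: "M = distr \<nu> borel (\<lambda>x. 10 * x - 5)"

lemma condensationI:
  assumes "compact_borel_prob \<nu>" "self_similar_nu \<nu>" "compact_borel_prob P" "condensation_identity \<nu> P"
  shows "condensation P \<nu> (distr \<nu> borel (\<lambda>x. 10 * x - 5))"
proof -
  have nu: "interval_prob \<nu> (2/5) (3/5)"
    using assms by (intro interval_prob_nu) (auto simp: compact_borel_prob_def)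
  have P: "interval_prob P 0 1"
    using assms nu by (intro interval_prob_P) (auto simp: compact_borel_prob_def)
  have S: "S1 = (\<lambda>x. x / 5)" "S2 = (\<lambda>x. x / 5 + 4/5)"
    by (auto simp: S1_def S2_def)
  then show ?thesis
    using P nu cantor_nu[OF nu assms(2)] integral_P[OF nu P assms(4), unfolded S]
    by (simp add: condensation_def condensation_axioms_def)
qed

context condensation
begin

lemma Err_nu:
  assumes "finite A" "A \<noteq> {}"
  shows "Err \<nu> A = 1/100 * Err M ((\<lambda>y. 10 * y - 5) ` A)"
proof -
  let ?B = "(\<lambda>y. 10 * y - 5) ` A"
  have [measurable]: "sqdist ?B \<in> borel_measurable borel"
    by (intro borel_measurable_continuous_onI continuous_sqdist) (use assms in auto)
  have "Err M ?B = (LINT x|\<nu>. sqdist ?B (10 * x - 5))"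
    unfolding Err_def M_eq by (subst integral_distr) simp_all
  also have "\<dots> = 100 * Err \<nu> A"
    using nu.Err_affine[of ?B 10 "-5"] assms by (simp add: image_image)
  finally show ?thesis by simp
qed

text \<open>Weights times squared ratios: 1/75 = 1/3 * 1/25 and 1/300 = 1/3 * 1/100.\<close>

lemma Err_P:
  assumes "finite A" "A \<noteq> {}"
  shows "Err P A = 1/75 * Err P ((\<lambda>y. 5 * y) ` A) + 1/75 * Err P ((\<lambda>y. 5 * y - 4) ` A) 
    + 1/300 * Err M ((\<lambda>y. 10 * y - 5) ` A)"
proof -
  have "Err P A = 1/3 * (LINT x|P. sqdist A (x/5)) + 1/3 * (LINT x|P. sqdist A (x/5 + 4/5)) + 1/3 * Err \<nu> A"
    unfolding Err_def by (rule integral_thirds) (use assms in \<open>auto intro: continuous_sqdist sqdist_nonneg\<close>)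
  then show ?thesis
    using P.Err_affine[OF assms, of "1/5" 0] P.Err_affine[OF assms, of "1/5" "4/5"] Err_nu[OF assms]
    by (simp add: power2_eq_square algebra_simps)
qed

text \<open>Two copies of one set \<open>A\<close> and one copy of a set \<open>B\<close> are placed
  in the three pieces. Factoring out 2/75 and 1/300 turns the price \<open>t\<close> into
  \<open>75 * t\<close> and \<open>300 * t\<close>.\<close>

lemma pen_P_le: 
  assumes "0 \<le> t"
  shows "pen P t \<le> 2/75 * pen P (75 * t) + 1/300 * pen M (300 * t)"
proof -
  have *: "pen P t \<le> 2/75 * (Err P A + 75 * t * real (card A)) + 1/300 * (Err M B + 300 * t * real (card B))"
    if A: "finite A" "A \<noteq> {}" and B: "finite B" "B \<noteq> {}" for A B
  proof -
    define C1 C2 C3 where "C1 = (\<lambda>y. y / 5) ` A" and "C2 = (\<lambda>y. y / 5 + 4/5) ` A" and "C3 = (\<lambda>y. y / 10 + 1/2) ` B"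
    let ?C = "C1 \<union> C2 \<union> C3"
    have C: "finite ?C" "?C \<noteq> {}" using A B by (auto simp: C1_def C2_def C3_def)
    have "A \<subseteq> (\<lambda>y. 5 * y) ` ?C" "A \<subseteq> (\<lambda>y. 5 * y - 4) ` ?C" "B \<subseteq> (\<lambda>y. 10 * y - 5) ` ?C"
      by (auto simp: C1_def C2_def C3_def image_Un image_image)
    then have "Err P ((\<lambda>y. 5 * y) ` ?C) \<le> Err P A" "Err P ((\<lambda>y. 5 * y - 4) ` ?C) \<le> Err P A"
      "Err M ((\<lambda>y. 10 * y - 5) ` ?C) \<le> Err M B"
      using C A B by (auto intro!: P.Err_antimono M.Err_antimono)
    then have E: "Err P ?C \<le> 2/75 * Err P A + 1/300 * Err M B" by (subst Err_P[OF C]) simp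
    have "card ?C \<le> card A + card A + card B"
      using card_Un_le[of "C1 \<union> C2" C3] card_Un_le[of C1 C2] card_image_le[OF A(1), of "\<lambda>y. y / 5"]
        card_image_le[OF A(1), of "\<lambda>y. y / 5 + 4/5"] card_image_le[OF B(1), of "\<lambda>y. y / 10 + 1/2"]
      by (simp add: C1_def C2_def C3_def)
    then have "real (card ?C) \<le> 2 * real (card A) + real (card B)" by linarith
    then have "t * real (card ?C) \<le> t * (2 * real (card A) + real (card B))" using assms by (intro mult_left_mono)
    then show ?thesis using pen_le[OF assms C, of P] E by (simp add: algebra_simps)
  qed
  \<comment> \<open>The bound \<open>*\<close> holds for independent \<open>A\<close> and
    \<open>B\<close>, so the two infima are taken one inside the other.\<close>
  have "75/2 * (pen P t - 1/300 * pen M (300 * t)) \<le> pen P (75 * t)"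
  proof (rule pen_ge)
    fix A :: "real set" assume A: "finite A" "A \<noteq> {}"
    have "300 * (pen P t - 2/75 * (Err P A + 75 * t * real (card A))) \<le> pen M (300 * t)"
    proof (rule pen_ge)
      fix B :: "real set" assume B: "finite B" "B \<noteq> {}"
      show "300 * (pen P t - 2/75 * (Err P A + 75 * t * real (card A))) \<le> Err M B + 300 * t * real (card B)"
        using *[OF A B] by (simp add: algebra_simps)
    qed
    then show "75/2 * (pen P t - 1/300 * pen M (300 * t)) \<le> Err P A + 75 * t * real (card A)" by (simp add: algebra_simps)
  qed
  then show ?thesis by simp
qed

text \<open>Adding the cut points \<open>3/10\<close> and \<open>7/10\<close> to a finite set makes its restrictions to the
  three pieces independent of one another.\<close>

lemma pen_P_ge: 
  assumes "0 \<le> t"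
  shows "2/75 * pen P (75 * t) + 1/300 * pen M (300 * t) \<le> pen P t + 4 * t"
proof -
  have "2/75 * pen P (75 * t) + 1/300 * pen M (300 * t) - 4 * t \<le> pen P t"
  proof (rule pen_ge)
    fix A :: "real set" assume A: "finite A" "A \<noteq> {}"
    define A1 where "A1 = {a \<in> A. a < 3/10}"
    define A2 where "A2 = {a \<in> A. 3/10 \<le> a \<and> a < 7/10}"
    define A3 where "A3 = {a \<in> A. 7/10 \<le> a}"
    \<comment> \<open>A cut is nearer to every point of a piece than anything beyond the cut. Each
      of the two cuts goes to both neighbouring pieces: four extra points, hence the error
      \<open>4 * t\<close>.\<close>
    define B1 where "B1 = insert (3/10) A1"
    define B2 where "B2 = insert (3/10) (insert (7/10) A2)"
    define B3 where "B3 = insert (7/10) A3"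
    have fin: "finite A1" "finite A2" "finite A3" using A by (auto simp: A1_def A2_def A3_def)
    have B: "finite B1" "B1 \<noteq> {}" "finite B2" "B2 \<noteq> {}" "finite B3" "B3 \<noteq> {}"
      using fin by (auto simp: B1_def B2_def B3_def)
    have le1: "sqdist B1 x \<le> sqdist A x" if "0 \<le> x" "x \<le> 1/5" for x
    proof (rule sqdist_le_sqdist[OF A B(1)])
      fix a assume "a \<in> A"
      then show "\<exists>b\<in>B1. \<bar>x - b\<bar> \<le> \<bar>x - a\<bar>"
        using that by (cases "a < 3/10") (auto simp: B1_def A1_def)
    qed
    have le2: "sqdist B2 x \<le> sqdist A x" if "2/5 \<le> x" "x \<le> 3/5" for x
    proof (rule sqdist_le_sqdist[OF A B(3)])
      fix a assume "a \<in> A"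
      then show "\<exists>b\<in>B2. \<bar>x - b\<bar> \<le> \<bar>x - a\<bar>"
        using that by (cases "a < 3/10"; cases "a < 7/10") (auto simp: B2_def A2_def)
    qed
    have le3: "sqdist B3 x \<le> sqdist A x" if "4/5 \<le> x" "x \<le> 1" for x
    proof (rule sqdist_le_sqdist[OF A B(5)])
      fix a assume "a \<in> A"
      then show "\<exists>b\<in>B3. \<bar>x - b\<bar> \<le> \<bar>x - a\<bar>"
        using that by (cases "a < 7/10") (auto simp: B3_def A3_def)
    qed
    have aff: "sqdist ((\<lambda>y. 5 * y - 5 * d) ` B) x = 25 * sqdist B (x / 5 + d)" if "finite B" "B \<noteq> {}" for B d x
      using sqdist_affine[OF that, of "1/5" x d] by (simp add: power2_eq_square algebra_simps)
    have aff': "sqdist ((\<lambda>y. 10 * y - 5) ` B) x = 100 * sqdist B (x / 10 + 1/2)" if "finite B" "B \<noteq> {}" for B x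
      using sqdist_affine[OF that, of "1/10" x "1/2"] by (simp add: power2_eq_square algebra_simps)
    have E1: "Err P ((\<lambda>y. 5 * y - 5 * 0) ` B1) \<le> Err P ((\<lambda>y. 5 * y - 5 * 0) ` A)"
    proof (rule P.Err_le_interval)
      fix x :: real assume "0 \<le> x" "x \<le> 1"
      then show "sqdist ((\<lambda>y. 5 * y - 5 * 0) ` B1) x \<le> sqdist ((\<lambda>y. 5 * y - 5 * 0) ` A) x"
        unfolding aff[OF B(1,2)] aff[OF A] by (intro mult_left_mono le1) auto
    qed (use A B in auto)
    have E2: "Err M ((\<lambda>y. 10 * y - 5) ` B2) \<le> Err M ((\<lambda>y. 10 * y - 5) ` A)"
    proof (rule M.Err_le_interval)
      fix x :: real assume "-1 \<le> x" "x \<le> 1"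
      then show "sqdist ((\<lambda>y. 10 * y - 5) ` B2) x \<le> sqdist ((\<lambda>y. 10 * y - 5) ` A) x"
        unfolding aff'[OF B(3,4)] aff'[OF A] by (intro mult_left_mono le2) auto
    qed (use A B in auto)
    have E3: "Err P ((\<lambda>y. 5 * y - 5 * (4/5)) ` B3) \<le> Err P ((\<lambda>y. 5 * y - 5 * (4/5)) ` A)"
    proof (rule P.Err_le_interval)
      fix x :: real assume "0 \<le> x" "x \<le> 1"
      then show "sqdist ((\<lambda>y. 5 * y - 5 * (4/5)) ` B3) x \<le> sqdist ((\<lambda>y. 5 * y - 5 * (4/5)) ` A) x"
        unfolding aff[OF B(5,6)] aff[OF A] by (intro mult_left_mono le3) auto
    qed (use A B in auto)
    have E: "1/75 * Err P ((\<lambda>y. 5 * y) ` B1) + 1/75 * Err P ((\<lambda>y. 5 * y - 4) ` B3) 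
        + 1/300 * Err M ((\<lambda>y. 10 * y - 5) ` B2) \<le> Err P A"
      using E1 E2 E3 by (subst Err_P[OF A]) simp
    have pens: "pen P (75 * t) \<le> Err P ((\<lambda>y. 5 * y) ` B1) + 75 * t * real (card B1)"
      "pen P (75 * t) \<le> Err P ((\<lambda>y. 5 * y - 4) ` B3) + 75 * t * real (card B3)"
      "pen M (300 * t) \<le> Err M ((\<lambda>y. 10 * y - 5) ` B2) + 300 * t * real (card B2)"
    proof -
      have card: "card ((\<lambda>y. 5 * y) ` B1) = card B1" "card ((\<lambda>y. 5 * y - 4) ` B3) = card B3"
          "card ((\<lambda>y. 10 * y - 5) ` B2) = card B2"
        by (auto intro!: card_image simp: inj_on_def)
      show "pen P (75 * t) \<le> Err P ((\<lambda>y. 5 * y) ` B1) + 75 * t * real (card B1)"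
        using pen_le[of "75 * t" "(\<lambda>y. 5 * y) ` B1" P] B assms card by simp
      show "pen P (75 * t) \<le> Err P ((\<lambda>y. 5 * y - 4) ` B3) + 75 * t * real (card B3)"
        using pen_le[of "75 * t" "(\<lambda>y. 5 * y - 4) ` B3" P] B assms card by simp
      show "pen M (300 * t) \<le> Err M ((\<lambda>y. 10 * y - 5) ` B2) + 300 * t * real (card B2)"
        using pen_le[of "300 * t" "(\<lambda>y. 10 * y - 5) ` B2" M] B assms card by simp
    qed
    have "card A1 + card A2 + card A3 = card (A1 \<union> A2 \<union> A3)"
      using fin by (subst card_Un_disjoint, auto simp: A1_def A2_def A3_def)+
    also have "A1 \<union> A2 \<union> A3 = A" by (auto simp: A1_def A2_def A3_def)
    finally have "card B1 + card B2 + card B3 \<le> card A + 4"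
      using fin card_insert_le_m1 by (simp add: B1_def B2_def B3_def card_insert_if)
    then have "real (card B1) + real (card B2) + real (card B3) \<le> real (card A) + 4" by linarith
    then have "t * (real (card B1) + real (card B2) + real (card B3)) \<le> t * (real (card A) + 4)"
      using assms by (intro mult_left_mono)
    then have "t * real (card B1) + t * real (card B2) + t * real (card B3) \<le> t * real (card A) + 4 * t"
      by (simp add: algebra_simps)
    then show "2/75 * pen P (75 * t) + 1/300 * pen M (300 * t) - 4 * t \<le> Err P A + t * real (card A)"
      using E pens by linarith
  qed
  then show ?thesis by simp
qed

text \<open>At price 1 / 18^j, at most 2^j points cost no more than 1 / 9^j, which leaves 1/2 of the
  constant 3/2 in \<open>Err_ge\<close> to the distortion; 1/600 = 1/300 * 1/2.\<close>

lemma quantization_error_P_ge: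
  assumes "1 \<le> n" "n \<le> 2 ^ j"
  shows "1 / 600 / 9 ^ j \<le> quantization_error n P"
proof (rule quantization_error_ge[OF assms(1)])
  fix A :: "real set" assume A: "finite A" "A \<noteq> {}" "card A \<le> n"
  let ?B = "(\<lambda>y. 10 * y - 5) ` A"
  have "real (card A) \<le> real (2 ^ j)" using A assms by linarith
  then have "real (card A) / 18 ^ j \<le> 2 ^ j / 18 ^ j" by (intro divide_right_mono) auto
  also have "(2::real) ^ j / 18 ^ j = 1 / 9 ^ j" by (simp flip: power_divide add: power_one_over)
  finally have c: "real (card A) / 18 ^ j \<le> 1 / 9 ^ j" .
  have "card ?B = card A" by (auto intro!: card_image simp: inj_on_def)
  then have "3/2 / 9 ^ j \<le> Err M ?B + real (card A) / 18 ^ j"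
    using M.Err_ge[of ?B j] A by simp
  then have "3/2 / 9 ^ j - 1 / 9 ^ j \<le> Err M ?B" using c by linarith
  moreover have "3/2 / 9 ^ j - 1 / 9 ^ j = 1/2 / (9::real) ^ j" by (simp add: field_simps)
  moreover have "1/300 * Err M ?B \<le> Err P A"
    using Err_P[OF A(1,2)] Err_nonneg[of "(\<lambda>y. 5 * y) ` A" P] Err_nonneg[of "(\<lambda>y. 5 * y - 4) ` A" P] A by simp
  ultimately show "1 / 600 / 9 ^ j \<le> Err P A" by simp
qed

end

subsection \<open>Asymptotics of the penalised error\<close>

text \<open>A power bound on the fundamental interval from \<open>\<delta>\<close> to
  \<open>b\<close> spreads to all smaller \<open>t\<close>, one factor \<open>s\<close> at a time;
  \<open>s * \<delta> \<le> b\<close> keeps \<open>s * t\<close> in range. The condition on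
  \<open>C\<close> says that one step of the recursion preserves the constant.\<close>

lemma powr_bound_of_scaling:
  fixes f :: "real \<Rightarrow> real"
  assumes "s > 1" "0 < \<delta>" "s * \<delta> \<le> b" "0 \<le> r" 
    and base: "\<And>t. \<delta> \<le> t \<Longrightarrow> t \<le> b \<Longrightarrow> f t \<le> C * t powr \<theta>"
    and rec: "\<And>t. 0 < t \<Longrightarrow> t \<le> \<delta> \<Longrightarrow> f t \<le> r * f (s * t) + D * t powr \<theta>"
    and C: "r * s powr \<theta> * C + D \<le> C"
    and t: "0 < t" "t \<le> b"
  shows "f t \<le> C * t powr \<theta>"
proof -
  have *: "f t \<le> C * t powr \<theta>" if "\<delta> / s ^ k \<le> t" "t \<le> b" for k t
    using that
  proof (induction k arbitrary: t)
    case (Suc k t)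
    have "0 < \<delta> / s ^ Suc k" using assms by simp
    then have "0 < t" using Suc.prems by linarith
    show ?case
    proof (cases "\<delta> \<le> t")
      case False
      have "\<delta> / s ^ k = s * (\<delta> / s ^ Suc k)" using assms by simp
      also have "\<dots> \<le> s * t" using Suc.prems assms by (intro mult_left_mono) auto
      finally have "f (s * t) \<le> C * (s * t) powr \<theta>"
      proof (rule Suc.IH)
        have "s * t \<le> s * \<delta>" using False \<open>s > 1\<close> by simp
        then show "s * t \<le> b" using assms by linarith
      qed
      then have "r * f (s * t) \<le> r * (C * (s * t) powr \<theta>)"
        using assms by (intro mult_left_mono)
      moreover have "f t \<le> r * f (s * t) + D * t powr \<theta>"
        using False \<open>0 < t\<close> by (intro rec) auto
      ultimately have "f t \<le> (r * s powr \<theta> * C + D) * t powr \<theta>"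
        using assms \<open>0 < t\<close> by (simp add: powr_mult algebra_simps)
      also have "\<dots> \<le> C * t powr \<theta>" using C by (intro mult_right_mono) auto
      finally show ?thesis .
    qed (use base Suc in auto)
  qed (use base in auto)
  obtain k where "\<delta> / t < s ^ k" using real_arch_pow[OF \<open>s > 1\<close>] by blast
  then have "\<delta> / s ^ k \<le> t" using t assms by (simp add: field_simps)
  then show ?thesis using * t by blast
qed

text \<open>With \<open>t = y powr - (p + 1)\<close> the penalised error becomes
  \<open>n powr p * V n * (n / y) powr - p + n / y\<close> after multiplication by \<open>y powr p\<close>, so that only the
  ratio \<open>n / y\<close> matters in the limit.\<close>

lemma penalty_limit:
  fixes M :: "real measure"
  assumes "p > 0" and lim: "(\<lambda>n. real n powr p * quantization_error n M) \<longlonglongrightarrow> L" and "L > 0"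
  obtains K where "((\<lambda>y. pen M (y powr - (p + 1)) * y powr p) \<longlongrightarrow> K) at_top"
proof -
  let ?V = "\<lambda>n. quantization_error n M"
  let ?q = "\<lambda>n. real n powr p * ?V n"
  \<comment> \<open>For large \<open>y\<close> the ratios \<open>n / y\<close> fill the positive
    reals, so the limit is an infimum over a real \<open>x\<close>.\<close>
  define K where "K = (INF x\<in>{0<..}. L * x powr - p + x)"
  have bdd: "bdd_below ((\<lambda>x. L * x powr - p + x) ` {0<..})"
    using \<open>L > 0\<close> by (intro bdd_belowI2[of _ 0]) auto
  have K_le: "K \<le> L * x powr - p + x" if "x > 0" for x
    unfolding K_def using that by (intro cINF_lower bdd) auto
  have K_nonneg: "0 \<le> K"
    unfolding K_def by (rule cINF_greatest) (use \<open>L > 0\<close> in auto)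
  have scale: "(?V n + y powr - (p + 1) * real n) * y powr p = ?q n * (real n / y) powr - p + real n / y"
    if "y > 0" "n \<ge> 1" for y n
  proof -
    have "y powr - (p + 1) * y powr p = 1 / y"
      using that by (simp add: powr_add[symmetric] powr_minus_divide)
    moreover have "real n powr p * (real n / y) powr - p = y powr p"
      using that by (simp add: powr_minus powr_divide field_simps)
    ultimately show ?thesis by (simp add: algebra_simps)
  qed
  have "((\<lambda>y. pen M (y powr - (p + 1)) * y powr p) \<longlongrightarrow> K) at_top"
  proof (rule order_tendstoI)
    fix a assume "K < a"
    then obtain x where x: "x > 0" "L * x powr - p + x < a"
      unfolding K_def using cINF_less_iff[OF _ bdd] by auto
    define n where "n y = nat \<lceil>x * y\<rceil>" for y
    have n_lim: "((\<lambda>y. real (n y) / y) \<longlongrightarrow> x) at_top"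
    proof (rule tendsto_sandwich)
      show "eventually (\<lambda>y. x \<le> real (n y) / y) at_top"
        using eventually_gt_at_top[of 0]
        by eventually_elim (use x in \<open>simp add: n_def field_simps of_nat_ceiling\<close>)
      show "eventually (\<lambda>y. real (n y) / y \<le> x + 1 / y) at_top"
        using eventually_gt_at_top[of 0]
      proof eventually_elim
        case (elim y)
        then have "real (n y) \<le> x * y + 1" using x by (simp add: n_def)
        then show ?case using elim by (simp add: field_simps)
      qed
      show "((\<lambda>y. x + 1 / y) \<longlongrightarrow> x) at_top" by real_asymp
    qed auto
    have "filterlim n at_top at_top"
      unfolding n_def using x by real_asymp
    then have "((\<lambda>y. ?q (n y)) \<longlongrightarrow> L) at_top"
      by (rule filterlim_compose[OF lim])
    then have "((\<lambda>y. ?q (n y) * (real (n y) / y) powr - p + real (n y) / y) \<longlongrightarrow> L * x powr - p + x) at_top"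
      using n_lim x by (intro tendsto_intros) auto
    then have "eventually (\<lambda>y. ?q (n y) * (real (n y) / y) powr - p + real (n y) / y < a) at_top"
      using x by (intro order_tendstoD)
    then show "eventually (\<lambda>y. pen M (y powr - (p + 1)) * y powr p < a) at_top"
      using eventually_gt_at_top[of 0]
    proof eventually_elim
      case (elim y)
      have "0 < x * y" using x elim by simp
      then have "n y \<ge> 1" unfolding n_def by linarith
      have "pen M (y powr - (p + 1)) * y powr p \<le> (?V (n y) + y powr - (p + 1) * real (n y)) * y powr p"
        using \<open>n y \<ge> 1\<close> by (intro mult_right_mono pen_le_quantization_error) auto
      also have "\<dots> < a" using elim \<open>n y \<ge> 1\<close> by (simp only: scale)
      finally show ?case .
    qed
  next
    fix a assume "a < K"
    show "eventually (\<lambda>y. a < pen M (y powr - (p + 1)) * y powr p) at_top"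
    proof (cases "a < 0")
      case True
      show ?thesis
      proof (rule always_eventually, rule allI)
        fix y :: real
        have "0 \<le> pen M (y powr - (p + 1)) * y powr p" by (intro mult_nonneg_nonneg pen_nonneg) auto
        then show "a < pen M (y powr - (p + 1)) * y powr p" using True by linarith
      qed
    next
      case False
      then have "K > 0" using \<open>a < K\<close> by linarith
      \<comment> \<open>The loss factor \<open>c < 1\<close> is paid for replacing
        \<open>?q n\<close> by its limit \<open>L\<close>, and is chosen so that
        \<open>c * K\<close> still exceeds \<open>a\<close>.\<close>
      obtain c where c: "a / K < c" "c < 1" using dense[of "a / K" 1] \<open>a < K\<close> \<open>K > 0\<close> by auto
      have "0 \<le> a / K" using False \<open>K > 0\<close> by simp
      then have c0: "c > 0" using c by linarith
      have "a < c * K" using c \<open>K > 0\<close> by (simp add: field_simps)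
      have "c * L < L" using c \<open>L > 0\<close> by simp
      then have "eventually (\<lambda>n. c * L < ?q n) sequentially"
        using order_tendstoD(1)[OF lim] by blast
      then obtain n0 where n0: "\<And>n. n \<ge> n0 \<Longrightarrow> c * L < ?q n"
        unfolding eventually_sequentially by blast
      \<comment> \<open>The limit says nothing about \<open>n < n0\<close>. Such \<open>n\<close>
        have error at least \<open>?V n1 > 0\<close>, which \<open>y powr p\<close> makes
        arbitrarily large.\<close>
      define n1 where "n1 = Suc n0"
      have "0 < c * L" using c0 \<open>L > 0\<close> by simp
      also have "\<dots> < ?q n1" by (rule n0) (simp add: n1_def)
      finally have "0 < ?q n1" .
      then have V1: "?V n1 > 0" by (simp add: zero_less_mult_iff)
      have "filterlim (\<lambda>y. ?V n1 * y powr p) at_top at_top"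
        using V1 \<open>p > 0\<close> by real_asymp
      then have "eventually (\<lambda>y. K \<le> ?V n1 * y powr p) at_top"
        by (simp add: filterlim_at_top)
      then show ?thesis using eventually_gt_at_top[of 0]
      proof eventually_elim
        case (elim y)
        have "c * K * y powr - p \<le> pen M (y powr - (p + 1))"
        proof (rule pen_ge_quantization_error)
          fix n :: nat assume n: "1 \<le> n"
          have "c * K \<le> (?V n + y powr - (p + 1) * real n) * y powr p"
          proof (cases "n \<ge> n0")
            case True
            have "c * K \<le> c * (L * (real n / y) powr - p + real n / y)"
              using c0 n elim by (intro mult_left_mono K_le) auto
            also have "\<dots> = c * L * (real n / y) powr - p + c * (real n / y)"
              by (simp add: algebra_simps)
            also have "\<dots> \<le> ?q n * (real n / y) powr - p + 1 * (real n / y)"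
              using n0[OF True] c elim by (intro add_mono mult_right_mono) auto
            finally show ?thesis using scale[OF elim(2) n] by simp
          next
            case False
            have "c * K \<le> K" using c \<open>K > 0\<close> by simp
            also have "\<dots> \<le> ?V n1 * y powr p" by fact
            also have "\<dots> \<le> (?V n + y powr - (p + 1) * real n) * y powr p"
            proof (rule mult_right_mono)
              have "?V n1 \<le> ?V n" using n False by (intro quantization_error_antimono) (auto simp: n1_def)
              then show "?V n1 \<le> ?V n + y powr - (p + 1) * real n"
                by (simp add: add_increasing2)
            qed auto
            finally show ?thesis .
          qed
          then show "c * K * y powr - p \<le> ?V n + y powr - (p + 1) * real n"
            using elim by (simp add: powr_minus field_simps)
        qed
        then have "c * K \<le> pen M (y powr - (p + 1)) * y powr p"
          using elim by (simp add: powr_minus field_simps)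
        then show ?case using \<open>a < c * K\<close> by linarith
      qed
    qed
  qed
  then show ?thesis using that by blast
qed

lemma powr_neg_powr:
  fixes y p :: real
  assumes "p > 0" shows "(y powr - (p + 1)) powr (p / (p + 1)) = y powr - p"
proof -
  have "- (p + 1) * (p / (p + 1)) = - p" using assms by (simp add: field_simps)
  then show ?thesis by (simp only: powr_powr)
qed

text \<open>A set of penalised cost below \<open>t * n\<close> has fewer than \<open>n\<close>
  points, so its distortion bounds the quantization error. It remains to choose \<open>t\<close> so
  that \<open>t * n\<close> matches the assumed bound.\<close>

lemma quantization_error_le_powr:
  assumes "p > 0" "C > 0" and bound: "\<And>t. 0 < t \<Longrightarrow> t \<le> 1 \<Longrightarrow> pen M t \<le> C * t powr (p / (p + 1))"
  obtains C' where "C' > 0" "eventually (\<lambda>n. real n powr p * quantization_error n M \<le> C') sequentially"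
proof
  show "2 * C * (2 * C) powr p > 0" using assms by simp
  show "eventually (\<lambda>n. real n powr p * quantization_error n M \<le> 2 * C * (2 * C) powr p) sequentially"
    using eventually_gt_at_top[of 0] eventually_ge_at_top[of "nat \<lceil>2 * C\<rceil>"]
  proof eventually_elim
    case (elim n)
    \<comment> \<open>With this \<open>y\<close>, \<open>t * n\<close> equals
      \<open>2 * C * y powr - p\<close>. The factor 2 makes the inequality for
      \<open>pen M t\<close> strict, as \<open>pen_approx\<close> requires.\<close>
    define y where "y = real n / (2 * C)"
    have "2 * C \<le> real n" using elim by linarith
    then have "y \<ge> 1" using assms by (simp add: y_def)
    define t where "t = y powr - (p + 1)"
    have t: "0 < t" "t \<le> 1" using \<open>y \<ge> 1\<close> assms powr_mono[of "- (p + 1)" 0 y] by (auto simp: t_def)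
    have "t powr (p / (p + 1)) = y powr - p"
      unfolding t_def by (rule powr_neg_powr) fact
    then have "pen M t \<le> C * y powr - p" using bound[OF t] by simp
    also have "\<dots> < 2 * C * y powr - p" using assms \<open>y \<ge> 1\<close> by simp
    finally obtain A where A: "finite A" "A \<noteq> {}" "Err M A + t * real (card A) < 2 * C * y powr - p"
      by (rule pen_approx)
    have "t * real (card A) < 2 * C * y powr - p" using A Err_nonneg[OF A(1,2), of M] by linarith
    also have "2 * C * y powr - p = t * real n"
    proof -
      have "y powr - p = t * y"
        using \<open>y \<ge> 1\<close> by (simp add: t_def powr_diff powr_minus field_simps powr_add)
      then show ?thesis using assms by (simp add: y_def)
    qed
    finally have "card A \<le> n" using t by simp
    then have "quantization_error n M \<le> Err M A" using A by (intro quantization_error_le)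
    also have "\<dots> \<le> 2 * C * y powr - p" using A t by (smt (verit) mult_nonneg_nonneg of_nat_0_le_iff)
    finally have "real n powr p * quantization_error n M \<le> real n powr p * (2 * C * y powr - p)"
      by (intro mult_left_mono) auto
    also have "\<dots> = 2 * C * (2 * C) powr p"
      using elim assms by (simp add: y_def powr_minus powr_divide)
    finally show ?case .
  qed
qed

subsection \<open>The quantization coefficients\<close>

text \<open>All of it rests on 2 powr p = 9. The last inequality is 75 powr (1 / (p + 1)) > 2, which
  follows from the value 2 at 18.\<close>

lemma order_exponent:
  fixes p :: real assumes "p = 2 / (ln 2 / ln 3)"
  shows "2 powr p = 9" "3 < p" "18 powr (1 / (p + 1)) = 2" "18 powr (p / (p + 1)) = 9" 
    "75 powr (p / (p + 1)) < 75 / 2"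
proof -
  have "p * ln 2 = 2 * ln 3" using assms by (simp add: field_simps)
  then have "2 powr p = exp (2 * ln (3::real))" by (simp add: powr_def)
  also have "\<dots> = 3 powr 2" by (simp add: powr_def)
  finally show p9: "2 powr p = 9" by simp
  show p3: "3 < p"
  proof (rule ccontr)
    assume "\<not> 3 < p"
    then have "2 powr p \<le> 2 powr 3" by (intro powr_mono) auto
    then show False using p9 by simp
  qed
  have e: "18 = 2 powr (p + 1)" using p9 by (simp add: powr_add)
  show e1: "18 powr (1 / (p + 1)) = 2" unfolding e powr_powr using p3 by simp
  show "18 powr (p / (p + 1)) = 9" unfolding e powr_powr using p3 p9 by simp
  have "2 < 75 powr (1 / (p + 1))"
    using e1 p3 powr_less_mono2[of "1 / (p + 1)" 18 75] by simp
  moreover have "75 powr (p / (p + 1)) * 75 powr (1 / (p + 1)) = 75"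
    using p3 by (simp add: powr_add[symmetric] add_divide_distrib[symmetric])
  moreover have "75 powr (p / (p + 1)) > (0::real)" by simp
  ultimately show "75 powr (p / (p + 1)) < 75 / 2"
    using mult_strict_left_mono[of 2 "75 powr (1 / (p + 1))" "75 powr (p / (p + 1))"] by simp
qed

context condensation
begin

text \<open>The critical case of the scaling lemma: 1/9 * 18 powr (p / (p + 1)) = 1, which leaves
  room only for \<open>D = 0\<close>. The range up to 300 accommodates arguments
  \<open>300 * t\<close>, and 301 dominates 1/2 + t on it.\<close>

lemma pen_M_le_powr:
  assumes p: "p = 2 / (ln 2 / ln 3)" and t: "0 < t" "t \<le> 300"
  shows "pen M t \<le> 301 * t powr (p / (p + 1))"
proof (rule powr_bound_of_scaling[where s = 18 and \<delta> = 1 and b = 300 and r = "1/9" and D = 0])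
  fix t :: real assume "1 \<le> t" "t \<le> 300"
  then have "pen M t \<le> 1/2 + t" by (intro M.pen_cantor_le_add) auto
  also have "\<dots> \<le> 301 * 1" using \<open>t \<le> 300\<close> by simp
  also have "\<dots> \<le> 301 * t powr (p / (p + 1))"
    using order_exponent(2)[OF p] \<open>1 \<le> t\<close> by (intro mult_left_mono ge_one_powr_ge_zero) auto
  finally show "pen M t \<le> 301 * t powr (p / (p + 1))" .
next
  show "1/9 * 18 powr (p / (p + 1)) * 301 + 0 \<le> (301 :: real)"
    using order_exponent(4)[OF p] by simp
qed (use t M.pen_cantor_le in auto)

lemma pen_P_le_powr:
  assumes p: "p = 2 / (ln 2 / ln 3)"
  obtains C where "C > 0" "\<And>t. 0 < t \<Longrightarrow> t \<le> 1 \<Longrightarrow> pen P t \<le> C * t powr (p / (p + 1))"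
proof -
  note p_facts = order_exponent[OF p]
  define \<theta> where "\<theta> = p / (p + 1)"
  have \<theta>: "0 \<le> \<theta>" "\<theta> \<le> 1" using p_facts(2) by (auto simp: \<theta>_def)
  define q where "q = 2/75 * 75 powr \<theta>"
  have q: "q < 1" using p_facts(5) by (simp add: q_def \<theta>_def)
  define D where "D = 301/300 * 300 powr \<theta>"
  define B where "B = Err P {0} + 1"
  have B: "B > 0" using Err_nonneg[of "{0}" P] by (simp add: B_def)
  \<comment> \<open>The first entry handles the base interval, where
    \<open>B \<le> 75 * B * t\<close>; the second solves \<open>q * C + D \<le> C\<close>.\<close>
  define C where "C = max (75 * B) (D / (1 - q))"
  have "C > 0" using B by (simp add: C_def)
  moreover have "pen P t \<le> C * t powr \<theta>" if t: "0 < t" "t \<le> 1" for t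
  proof (rule powr_bound_of_scaling[where s = 75 and \<delta> = "1/75" and b = 1 and r = "2/75" and D = D])
    fix t :: real assume t: "1/75 \<le> t" "t \<le> 1"
    have "pen P t \<le> Err P {0} + t" using pen_le[of t "{0}" P] t by simp
    also have "\<dots> \<le> B" using t by (simp add: B_def)
    also have "\<dots> \<le> 75 * B * t" using t B by simp
    also have "\<dots> \<le> C * t powr \<theta>"
    proof (rule mult_mono)
      show "t \<le> t powr \<theta>" using powr_mono'[of \<theta> 1 t] t \<theta> by simp
    qed (use B \<open>C > 0\<close> t in \<open>auto simp: C_def\<close>)
    finally show "pen P t \<le> C * t powr \<theta>" .
  next
    fix t :: real assume t: "0 < t" "t \<le> 1/75"
    have "pen P t \<le> 2/75 * pen P (75 * t) + 1/300 * pen M (300 * t)" using t by (intro pen_P_le) auto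
    also have "\<dots> \<le> 2/75 * pen P (75 * t) + 1/300 * (301 * (300 * t) powr \<theta>)"
      using pen_M_le_powr[OF p, of "300 * t"] t unfolding \<theta>_def by (intro add_left_mono mult_left_mono) auto
    also have "\<dots> = 2/75 * pen P (75 * t) + D * t powr \<theta>"
      using t by (simp add: D_def powr_mult)
    finally show "pen P t \<le> 2/75 * pen P (75 * t) + D * t powr \<theta>" .
  next
    have "D / (1 - q) \<le> C" by (simp add: C_def)
    then have "D \<le> C * (1 - q)" using q by (simp add: pos_divide_le_eq)
    then show "2/75 * 75 powr \<theta> * C + D \<le> C" by (simp add: q_def algebra_simps)
  qed (use t in auto)
  ultimately show ?thesis using that unfolding \<theta>_def by blast
qed

text \<open>With \<open>n\<close> between consecutive powers of two, the upper one bounds the error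
  and the lower one bounds \<open>n powr p\<close>. The mismatch costs a factor 9, and 5400 = 9 *
  600.\<close>

lemma quantization_error_P_ge_powr:
  assumes p: "p = 2 / (ln 2 / ln 3)" and "1 \<le> n"
  shows "1/5400 \<le> real n powr p * quantization_error n P"
proof -
  note p_facts = order_exponent[OF p]
  obtain j where j: "2 ^ j \<le> n" "n < 2 ^ (j + 1)" using ex_power_ivl1[of 2 n] assms by auto
  have "1 / 600 / 9 ^ Suc j \<le> quantization_error n P"
    using quantization_error_P_ge[of n "Suc j"] assms j by simp
  moreover have "9 ^ j \<le> real n powr p"
  proof -
    have "9 ^ j = (2 powr p) ^ j" using p_facts(1) by simp
    also have "\<dots> = (2 ^ j) powr p"
      by (simp add: powr_powr powr_realpow[symmetric] mult.commute)
    also have "\<dots> \<le> real n powr p"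
    proof (rule powr_mono2)
      have "real (2 ^ j) \<le> real n" using j by (subst of_nat_le_iff)
      then show "2 ^ j \<le> real n" by simp
    qed (use p_facts in auto)
    finally show ?thesis .
  qed
  ultimately have "9 ^ j * (1 / 600 / 9 ^ Suc j) \<le> real n powr p * quantization_error n P"
    by (intro mult_mono) auto
  then show ?thesis by simp
qed

text \<open>In the variable \<open>y\<close>, multiplying the price by 75 is dividing
  \<open>y\<close> by \<open>c\<close>, so both terms with \<open>P\<close> have limits. The error
  \<open>4 * t\<close> becomes \<open>4 / y\<close>, and the term with \<open>M\<close> is
  squeezed.\<close>

lemma pen_M_limit:
  assumes p: "p = 2 / (ln 2 / ln 3)" 
    and lim: "((\<lambda>y. pen P (y powr - (p + 1)) * y powr p) \<longlongrightarrow> K) at_top"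
  obtains K' where "((\<lambda>y. pen M (300 * y powr - (p + 1)) * y powr p) \<longlongrightarrow> K') at_top"
proof -
  note p_facts = order_exponent[OF p]
  define H where "H y = pen P (y powr - (p + 1)) * y powr p" for y
  define c :: real where "c = 75 powr (1 / (p + 1))"
  have c: "c > 0" "c powr (p + 1) = 75" using p_facts(2) by (auto simp: c_def powr_powr)
  have H_lim: "(H \<longlongrightarrow> K) at_top" using lim by (simp add: H_def[abs_def])
  have "filterlim (\<lambda>y. y / c) at_top at_top" using c by real_asymp
  then have Hc_lim: "((\<lambda>y. H (y / c)) \<longlongrightarrow> K) at_top" by (rule filterlim_compose[OF H_lim])
  have Hc: "pen P (75 * y powr - (p + 1)) * y powr p = c powr p * H (y / c)" if "y > 0" for y
  proof -
    have "(y / c) powr - (p + 1) = 75 * y powr - (p + 1)"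
      using that c by (simp add: powr_minus_divide powr_divide del: minus_add_distrib)
    moreover have "c powr p * (y / c) powr p = y powr p" using that c by (simp add: powr_divide)
    ultimately show ?thesis by (simp add: H_def)
  qed
  define G where "G y = 1/300 * (pen M (300 * y powr - (p + 1)) * y powr p)" for y
  have "(G \<longlongrightarrow> K - 2/75 * (c powr p * K)) at_top"
  proof (rule tendsto_sandwich)
    have *: "pen P (y powr - (p + 1)) * y powr p \<le> (2/75 * pen P (75 * y powr - (p + 1)) + 1/300 * pen M (300 * y powr - (p + 1))) * y powr p" for y
      by (intro mult_right_mono pen_P_le) auto
    have **: "(2/75 * pen P (75 * y powr - (p + 1)) + 1/300 * pen M (300 * y powr - (p + 1))) * y powr p 
        \<le> (pen P (y powr - (p + 1)) + 4 * y powr - (p + 1)) * y powr p" for y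
      by (intro mult_right_mono pen_P_ge) auto
    have *: "H y \<le> 2/75 * (c powr p * H (y / c)) + G y" if "y > 0" for y
      using *[of y] Hc[OF that] by (simp add: H_def G_def algebra_simps)
    have **: "2/75 * (c powr p * H (y / c)) + G y \<le> H y + 4 / y" if "y > 0" for y
    proof -
      have "y powr - (p + 1) * y powr p = 1 / y"
        using that by (simp add: powr_add[symmetric] powr_minus_divide)
      then show ?thesis using **[of y] Hc[OF that] by (simp add: H_def G_def algebra_simps)
    qed
    show "eventually (\<lambda>y. H y - 2/75 * (c powr p * H (y / c)) \<le> G y) at_top"
      using eventually_gt_at_top[of 0] by eventually_elim (use * in force)
    show "eventually (\<lambda>y. G y \<le> H y - 2/75 * (c powr p * H (y / c)) + 4 / y) at_top"
      using eventually_gt_at_top[of 0] by eventually_elim (use ** in force)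
    show base: "((\<lambda>y. H y - 2/75 * (c powr p * H (y / c))) \<longlongrightarrow> K - 2/75 * (c powr p * K)) at_top"
      by (intro tendsto_intros H_lim Hc_lim)
    have "((\<lambda>y::real. 4 / y) \<longlongrightarrow> 0) at_top" by real_asymp
    from tendsto_add[OF base this]
    show "((\<lambda>y. H y - 2/75 * (c powr p * H (y / c)) + 4 / y) \<longlongrightarrow> K - 2/75 * (c powr p * K)) at_top"
      by simp
  qed
  then have "((\<lambda>y. 300 * G y) \<longlongrightarrow> 300 * (K - 2/75 * (c powr p * K))) at_top"
    by (intro tendsto_intros)
  then show ?thesis using that by (simp add: G_def)
qed

text \<open>A limit of the penalised error of \<open>M\<close> would be sampled along \<open>t = 1 / 18 ^ j\<close> and along
  \<open>t = 3/2 / 18 ^ j\<close>, where the bounds \<open>3/2 / 9 ^ j\<close> from below and \<open>2 / 9 ^ j\<close> from above are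
  incompatible with a pure power of exponent \<open>p / (p + 1) > 3/4\<close>, because \<open>(3/2)^3 > (4/3)^4\<close>.\<close>

lemma pen_M_no_limit:
  assumes p: "p = 2 / (ln 2 / ln 3)" 
  shows "\<not> ((\<lambda>y. pen M (300 * y powr - (p + 1)) * y powr p) \<longlongrightarrow> K) at_top"
proof
  assume lim: "((\<lambda>y. pen M (300 * y powr - (p + 1)) * y powr p) \<longlongrightarrow> K) at_top"
  note p_facts = order_exponent[OF p]
  define \<theta> where "\<theta> = p / (p + 1)"
  have pw: "(2 ^ j) powr p = 9 ^ j" "(2 ^ j) powr (p + 1) = 18 ^ j" for j :: nat
  proof -
    have "(2 ^ j) powr p = (2 powr p) ^ j" "(2 ^ j) powr (p + 1) = (2 powr (p + 1)) ^ j"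
      by (simp_all add: powr_powr powr_realpow[symmetric] mult.commute)
    then show "(2 ^ j) powr p = 9 ^ j" "(2 ^ j) powr (p + 1) = 18 ^ j"
      using p_facts(1) by (simp_all add: powr_add)
  qed
  \<comment> \<open>Sampling at y = a powr (1 / (p + 1)) * 2^j gives the price 300 / a / 18^j. Then
    \<open>a = 300\<close> and \<open>a = 200\<close> produce 1 / 18^j and 3/2 / 18^j.\<close>
  have sample: "(\<lambda>j. pen M (300 / a / 18 ^ j) * (a powr \<theta> * 9 ^ j)) \<longlonglongrightarrow> K" if "a > 0" for a
  proof -
    define b where "b = a powr (1 / (p + 1))"
    have b: "b > 0" "b powr (p + 1) = a" "b powr p = a powr \<theta>"
      using that p_facts(2) by (auto simp: b_def powr_powr \<theta>_def)
    have "filterlim (\<lambda>j. b * 2 ^ j) at_top sequentially" using b(1) by real_asymp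
    from filterlim_compose[OF lim this] show ?thesis
      using b(1) by (simp add: powr_minus_divide powr_mult pw b del: minus_add_distrib)
  qed
  have "3/2 * 300 powr \<theta> \<le> K"
  proof (rule LIMSEQ_le_const[OF sample[of 300]])
    have "3/2 * 300 powr \<theta> = 3/2 / 9 ^ j * (300 powr \<theta> * 9 ^ j)" for j :: nat by simp
    also have "\<dots> j \<le> pen M (300 / 300 / 18 ^ j) * (300 powr \<theta> * 9 ^ j)" for j :: nat
      using M.pen_ge_cantor[of j] by (intro mult_right_mono) auto
    finally show "\<exists>N. \<forall>j\<ge>N. 3/2 * 300 powr \<theta> \<le> pen M (300 / 300 / 18 ^ j) * (300 powr \<theta> * 9 ^ j)" by blast
  qed simp
  moreover have "K \<le> 2 * 200 powr \<theta>"
  proof (rule LIMSEQ_le_const2[OF sample[of 200]])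
    have "pen M (300 / 200 / 18 ^ j) * (200 powr \<theta> * 9 ^ j) \<le> 2 * 200 powr \<theta>" for j :: nat
    proof -
      have "pen M (300 / 200 / 18 ^ j) * (200 powr \<theta> * 9 ^ j) \<le> 2 / 9 ^ j * (200 powr \<theta> * 9 ^ j)"
        using M.pen_cantor_pow_le[of "3/2" j] by (intro mult_right_mono) auto
      then show ?thesis by simp
    qed
    then show "\<exists>N. \<forall>j\<ge>N. pen M (300 / 200 / 18 ^ j) * (200 powr \<theta> * 9 ^ j) \<le> 2 * 200 powr \<theta>" by blast
  qed simp
  moreover have "(300 :: real) powr \<theta> = (3/2) powr \<theta> * 200 powr \<theta>"
    by (simp flip: powr_mult)
  ultimately have "(3/2 * (3/2) powr \<theta>) * 200 powr \<theta> \<le> 2 * 200 powr \<theta>"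
    by (simp only: mult.assoc)
  then have "(3/2) powr \<theta> \<le> (4/3 :: real)" by (simp add: mult_le_cancel_right)
  moreover have "(3/2) powr (3/4) \<le> (3/2 :: real) powr \<theta>"
    using p_facts(2) by (intro powr_mono) (auto simp: \<theta>_def field_simps)
  ultimately have "(3/2) powr (3/4) \<le> (4/3 :: real)" by linarith
  then have "((3/2) powr (3/4)) ^ 4 \<le> (4/3 :: real) ^ 4" by (intro power_mono) auto
  moreover have "((3/2 :: real) powr (3/4)) ^ 4 = (3/2) ^ 3"
    by (simp add: powr_power)
  ultimately show False by (simp add: power_divide)
qed

end

theorem theorem3p4p2:
  fixes \<nu> P :: "real measure" and \<beta> :: real
  assumes "compact_borel_prob \<nu>" and "self_similar_nu \<nu>"
    and "compact_borel_prob P" and "condensation_identity \<nu> P"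
    and "\<beta> = ln 2 / ln 3"
  shows "\<not> convergent (quantization_seq \<beta> P)
    \<and> 0 < lower_quantization_coeff \<beta> P \<and> lower_quantization_coeff \<beta> P < \<infinity>
    \<and> 0 < upper_quantization_coeff \<beta> P \<and> upper_quantization_coeff \<beta> P < \<infinity>"
proof -
  define M where "M = distr \<nu> borel (\<lambda>x. 10 * x - 5)"
  interpret condensation P \<nu> M
    unfolding M_def by (rule condensationI) fact+
  define p where "p = 2 / \<beta>"
  have p: "p = 2 / (ln 2 / ln 3)" using assms by (simp add: p_def)
  have "p > 0" using order_exponent(2)[OF p] by simp
  let ?q = "\<lambda>n. real n powr p * quantization_error n P"
  have seq: "quantization_seq \<beta> P = ?q" by (auto simp: quantization_seq_def p_def)
  have ge: "1/5400 \<le> ?q n" if "1 \<le> n" for n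
    using quantization_error_P_ge_powr[OF p that] .
  have "\<not> convergent ?q"
  proof
    assume "convergent ?q"
    then obtain L where L: "?q \<longlonglongrightarrow> L" by (auto simp: convergent_def)
    \<comment> \<open>The lower bound excludes the limit 0, which \<open>penalty_limit\<close> does
      not cover.\<close>
    have "1/5400 \<le> L" by (rule LIMSEQ_le_const[OF L]) (use ge in auto)
    then have "L > 0" by simp
    then obtain K where "((\<lambda>y. pen P (y powr - (p + 1)) * y powr p) \<longlongrightarrow> K) at_top"
      using penalty_limit[OF \<open>p > 0\<close> L] by blast
    then obtain K' where "((\<lambda>y. pen M (300 * y powr - (p + 1)) * y powr p) \<longlongrightarrow> K') at_top"
      using pen_M_limit[OF p] by blast
    then show False using pen_M_no_limit[OF p] by blast
  qed
  moreover have lower: "ereal (1/5400) \<le> liminf (\<lambda>n. ereal (?q n))"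
    by (rule Liminf_bounded) (use ge in \<open>auto simp: eventually_sequentially\<close>)
  moreover obtain C where C: "eventually (\<lambda>n. ?q n \<le> C) sequentially"
  proof -
    obtain C0 where "C0 > 0" "\<And>t. 0 < t \<Longrightarrow> t \<le> 1 \<Longrightarrow> pen P t \<le> C0 * t powr (p / (p + 1))"
      using pen_P_le_powr[OF p] by blast
    then show ?thesis using quantization_error_le_powr[OF \<open>p > 0\<close>] that by blast
  qed
  then have upper: "limsup (\<lambda>n. ereal (?q n)) \<le> ereal C"
    by (intro Limsup_bounded) auto
  moreover have "liminf (\<lambda>n. ereal (?q n)) \<le> limsup (\<lambda>n. ereal (?q n))"
    by (rule Liminf_le_Limsup) simp
  moreover have "(0::ereal) < ereal (1/5400)" "ereal C < \<infinity>" by simp_all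
  ultimately show ?thesis
    unfolding lower_quantization_coeff_def upper_quantization_coeff_def seq
    by (meson less_le_trans le_less_trans)
qed

end
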